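(* Consider a general stochastic matching model with impatience with compatibility graph $G=(\mathbb V,E)$, admissible matching policy $\Phi$, unit inter-arrival times, and IID marks $(P_n,V_n)_{n\in\mathbb Z}$ in $\mathbb R_+\times\mathbb V$ (patience time and class), the generic patience time $P$ being integrable. If $\mathbb P(P\le 1)>0$, then the profile Markov chain $(X_n)_{n\in\mathbb Z}$ admits a unique stationary distribution. If moreover there exists $m>0$ such that $\mathbb P(P\le m)=1$, then the sampling algorithm described in the context (started from $m$) terminates almost surely, and its output is sampled from the stationary distribution of $(X_n)_{n\in\mathbb Z}$.
   Context: Model. $G=(\mathbb V,E)$ is a finite, simple, connected, undirected graph; classes $i,j\in\mathbb V$ are compatible if $\{i,j\}\in E$. At each integer time $n$, one item of class $V_n\in\mathbb V$ and patience time $P_n\in\mathbb R_+$ enters the system; $P_n$ and $V_n$ need not be independent, but the pairs $(P_n,V_n)$ are IID in $n$. If the buffer contains items of a class compatible with $V_n$, the incoming item is matched with one of them, chosen by the matching policy $\Phi$, and both leave immediately; otherwise the incoming item is stored. An item that has not been matched by the end of its patience time leaves forever. Profile. The state space is $\mathbb X=\{\emptyset\}\cup\bigcup_{q\ge1}(\mathbb R_+^*\times\mathbb V)^q$ with $\mathbb R_+^*=(0,\infty)$. The profile $X(t)$ lists, in order of arrival, the pairs (remaining patience, class) of the items in the system at time $t$ ($\emptyset$ if the system is empty), and $X_n=X(n^-)$ is the profile just before the arrival at time $n$. The policy $\Phi$ is admissible if, upon each arrival, the choice of the match amongst compatible items in line at $t$, if any, is made according to the sole knowledge of $X(t)$,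 and possibly of a draw that is independent of everything else. Recursion. $X_{n+1}=f^\Phi(X_n,(P_n,V_n))$, where $f^\Phi(x,(p,v))$ is obtained as follows (up to the possible independent draw): if some item in $x$ has class compatible with $v$, remove from $x$ the pair of the item chosen by $\Phi$; otherwise append $(p,v)$ at the end of $x$; then delete all pairs whose remaining patience is at most $1$, and subtract $1$ from the remaining patience in all other pairs. Algorithm. Let $g(y,p)=[\max(y,p)-1]^+$ on $\mathbb R_+\times\mathbb R_+$. For successive starting times $T=-1,-2,-4,\dots$ ($T=-2^j$, $j\ge0$), using one and the same realization of the marks $(p_n,v_n)$, $n<0$, drawn independently with the law of $(P,V)$, set $Y_T=m$ and $Y_{n+1}=g(Y_n,p_n)$, until the first time $i\le0$ with $Y_i=0$. If there is no such $i$, pass to the starting time $2T$. Otherwise set $X=\emptyset$ at time $i$, apply $X\leftarrow f^\Phi(X,(p_n,v_n))$ for $n=i,\dots,-1$, and output the resulting $X$. *)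

theory Defs
  imports "Graph_Theory.Graph_Theory" "HOL-Probability.Probability"
begin

text \<open>
  Simple undirected graphs are the symmetric, loop-free \<open>pair_graph\<close>s: the edge
  \<open>{i, j}\<close> is the pair of arcs \<open>(i, j)\<close> and \<open>(j, i)\<close>.
\<close>

definition compatible :: "'v pair_pre_digraph \<Rightarrow> 'v \<Rightarrow> 'v \<Rightarrow> bool" where
  "compatible G i j \<longleftrightarrow> (i, j) \<in> parcs G"

definition has_match :: "'v pair_pre_digraph \<Rightarrow> (real \<times> 'v) list \<Rightarrow> 'v \<Rightarrow> bool" where
  "has_match G x v \<longleftrightarrow> (\<exists>k < length x. compatible G (snd (x ! k)) v)"

definition mark_space :: "'v pair_pre_digraph \<Rightarrow> (real \<times> 'v) measure" where
  "mark_space G = restrict_space borel {0..} \<Otimes>\<^sub>M count_space (pverts G)"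

text \<open>
  Profiles are finite lists of (remaining patience, class), in order of arrival. The state space
  is the disjoint union over \<open>q\<close> of the \<open>q\<close>-fold powers of the item space; its
  sigma-algebra is generated by the finite-dimensional rectangles, where
  \<open>listset [A\<^sub>1, \<dots>, A\<^sub>q]\<close> is \<open>A\<^sub>1 \<times> \<dots> \<times> A\<^sub>q\<close>.
\<close>

definition item_space :: "'v pair_pre_digraph \<Rightarrow> (real \<times> 'v) measure" where
  "item_space G = restrict_space borel {0<..} \<Otimes>\<^sub>M count_space (pverts G)"

definition profile_space :: "'v pair_pre_digraph \<Rightarrow> (real \<times> 'v) list measure" where
  "profile_space G = sigma (lists (space (item_space G))) (listset ` lists (sets (item_space G)))"

text \<open>
  A policy \<open>\<Phi>\<close> maps the current profile, the class of the incoming item and an independent draw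
  with law \<open>D\<close> to the position in the profile of the item to be matched. Its value is irrelevant
  if no stored item is compatible. Policies without randomisation simply ignore the draw.
\<close>

definition admissible ::
  "'v pair_pre_digraph \<Rightarrow> 'u measure \<Rightarrow> ((real \<times> 'v) list \<Rightarrow> 'v \<Rightarrow> 'u \<Rightarrow> nat) \<Rightarrow> bool" where
  "admissible G D \<Phi> \<longleftrightarrow>
     (\<lambda>(x, v, u). \<Phi> x v u) \<in>
       profile_space G \<Otimes>\<^sub>M (count_space (pverts G) \<Otimes>\<^sub>M D) \<rightarrow>\<^sub>M count_space UNIV \<and>
     (\<forall>x \<in> space (profile_space G). \<forall>v \<in> pverts G. \<forall>u \<in> space D.
        has_match G x v \<longrightarrow>
          \<Phi> x v u < length x \<and> compatible G (snd (x ! \<Phi> x v u)) v)"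

definition remove_at :: "nat \<Rightarrow> 'a list \<Rightarrow> 'a list" where
  "remove_at k x = take k x @ drop (Suc k) x"

definition elapse :: "(real \<times> 'v) list \<Rightarrow> (real \<times> 'v) list" where
  "elapse x = map (\<lambda>(r, c). (r - 1, c)) (filter (\<lambda>(r, c). r > 1) x)"

definition update ::
  "'v pair_pre_digraph \<Rightarrow> ((real \<times> 'v) list \<Rightarrow> 'v \<Rightarrow> 'u \<Rightarrow> nat) \<Rightarrow>
   (real \<times> 'v) list \<Rightarrow> real \<times> 'v \<Rightarrow> 'u \<Rightarrow> (real \<times> 'v) list" where
  "update G \<Phi> x z u =
     elapse (if has_match G x (snd z) then remove_at (\<Phi> x (snd z) u) x else x @ [z])"

definition profile_kernel ::
  "'v pair_pre_digraph \<Rightarrow> ((real \<times> 'v) list \<Rightarrow> 'v \<Rightarrow> 'u \<Rightarrow> nat) \<Rightarrow>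
   (real \<times> 'v) measure \<Rightarrow> 'u measure \<Rightarrow> (real \<times> 'v) list \<Rightarrow> (real \<times> 'v) list measure" where
  "profile_kernel G \<Phi> \<mu> D x =
     distr (\<mu> \<Otimes>\<^sub>M D) (profile_space G) (\<lambda>(z, u). update G \<Phi> x z u)"

definition stationary_distribution :: "'s measure \<Rightarrow> ('s \<Rightarrow> 's measure) \<Rightarrow> 's measure \<Rightarrow> bool" where
  "stationary_distribution S K \<pi> \<longleftrightarrow>
     prob_space \<pi> \<and> sets \<pi> = sets S \<and>
     (\<forall>A \<in> sets S. emeasure \<pi> A = (\<integral>\<^sup>+ x. emeasure (K x) A \<partial>\<pi>))"

definition patience_step :: "real \<Rightarrow> real \<Rightarrow> real" where
  "patience_step y p = max (max y p - 1) 0"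

text \<open>\<open>dominating p m T n\<close> is \<open>Y\<^sub>n\<close> for the recursion started from \<open>Y\<^sub>T = m\<close>, for \<open>n \<ge> T\<close>.\<close>

definition dominating :: "(int \<Rightarrow> real) \<Rightarrow> real \<Rightarrow> int \<Rightarrow> int \<Rightarrow> real" where
  "dominating p m T n = fold (\<lambda>k y. patience_step y (p k)) [T..n - 1] m"

definition zero_times :: "(int \<Rightarrow> real) \<Rightarrow> real \<Rightarrow> int \<Rightarrow> int set" where
  "zero_times p m T = {i \<in> {T..0}. dominating p m T i = 0}"

definition sampler_terminates :: "(int \<Rightarrow> real) \<Rightarrow> real \<Rightarrow> bool" where
  "sampler_terminates p m \<longleftrightarrow> (\<exists>j::nat. zero_times p m (- (2 ^ j)) \<noteq> {})"

text \<open>\<open>None\<close> stands for a run that never stops.\<close>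

definition sampler ::
  "'v pair_pre_digraph \<Rightarrow> ((real \<times> 'v) list \<Rightarrow> 'v \<Rightarrow> 'u \<Rightarrow> nat) \<Rightarrow> real \<Rightarrow>
   (int \<Rightarrow> real) \<Rightarrow> (int \<Rightarrow> 'v) \<Rightarrow> (int \<Rightarrow> 'u) \<Rightarrow> (real \<times> 'v) list option" where
  "sampler G \<Phi> m p v u =
     (if sampler_terminates p m then
        let j = (LEAST j::nat. zero_times p m (- (2 ^ j)) \<noteq> {});
            i = Min (zero_times p m (- (2 ^ j)))
        in Some (fold (\<lambda>n x. update G \<Phi> x (p n, v n) (u n)) [i..- 1] [])
      else None)"

end

theory Submission
  imports Defs
begin

text \<open>
  The idea is coupling from the past. Let all arrivals be driven by one doubly infinite IID sequence,
  and run the recursion from a remote time \<open>-n\<close> up to time 0. A stored item leaves at the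
  latest when its patience is used up, whatever the policy does; hence the system is empty at time
  \<open>i\<close> as soon as every item that arrived at a time \<open>k < i\<close> had patience at most
  \<open>i - k\<close> and the initial items have expired. Call such an \<open>i\<close> a regeneration time.
  Once \<open>-n\<close> is early enough, the run from any initial profile is empty at \<open>i\<close>, so its
  value at time 0 is the run from the empty profile at \<open>i\<close>: it depends neither on \<open>n\<close> nor on
  the initial profile.

  Regeneration times exist almost surely (\<open>AE_ex_countdown\<close>). The probability that a given time
  is one is the product of the \<open>P(P \<le> k)\<close>, \<open>k \<ge> 1\<close>; it is positive because no factor
  vanishes, as \<open>P(P \<le> 1) > 0\<close>, and because integrability makes the sum of the
  \<open>P(P > k)\<close> finite. This bound is the same for all times, so infinitely many regenerations in the
  past have positive probability, and being a tail event this has probability 1 by Kolmogorov's law.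

  Let \<open>X\<close> be the common limit of the runs. The run from \<open>x\<close> started at \<open>-n\<close> has the
  \<open>n\<close>-step transition law of \<open>x\<close> (\<open>distr_path\<close>), so that these laws converge on every
  measurable set to the law of \<open>X\<close>, for every \<open>x\<close>. Passing to the limit in the
  Chapman-Kolmogorov equation shows that the law of \<open>X\<close> is stationary; integrating the convergence
  against any stationary distribution shows that there is no other one
  (\<open>coupling_from_the_past\<close>).

  For the algorithm, the sequence \<open>Y\<close> started from \<open>m\<close> dominates all remaining patience
  times, provided that the stored items and the arrivals have patience at most \<open>m\<close>. So a zero of
  \<open>Y\<close> at time \<open>i\<close> certifies that the system is empty at \<open>i\<close> for every earlier starting
  time, and the output is \<open>X\<close>. Conversely a regeneration time forces a zero of \<open>Y\<close> from
  all early enough starting times, whence termination.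

  Laws of profiles make sense only if the one-step map is jointly measurable in the profile, the mark
  and the draw (\<open>measurable_update\<close>); this is proved from the rectangles that generate the
  sigma-algebra.
\<close>

section \<open>Runs of the recursion and the dominating sequence\<close>

definition run ::
  "'v pair_pre_digraph \<Rightarrow> ((real \<times> 'v) list \<Rightarrow> 'v \<Rightarrow> 'u \<Rightarrow> nat) \<Rightarrow>
   (int \<Rightarrow> (real \<times> 'v) \<times> 'u) \<Rightarrow> int \<Rightarrow> int \<Rightarrow> (real \<times> 'v) list \<Rightarrow> (real \<times> 'v) list" where
  "run G \<Phi> w s t x = fold (\<lambda>n y. update G \<Phi> y (fst (w n)) (snd (w n))) [s..t - 1] x"

lemma run_refl: "run G \<Phi> w s s x = x"
  by (simp add: run_def)

lemma run_step:
  assumes "s \<le> t"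
  shows "run G \<Phi> w s (t + 1) x = update G \<Phi> (run G \<Phi> w s t x) (fst (w t)) (snd (w t))"
  using assms by (simp add: run_def upto_rec2)

lemma run_split:
  assumes "s \<le> r" "r \<le> t"
  shows "run G \<Phi> w s t x = run G \<Phi> w r t (run G \<Phi> w s r x)"
proof (cases "r = t")
  case False
  then have "[s..t - 1] = [s..r - 1] @ [r..t - 1]"
    using assms by (intro upto_split1) auto
  then show ?thesis by (simp add: run_def)
qed (simp add: run_refl)

lemma run_cong:
  assumes "\<And>k. s \<le> k \<Longrightarrow> k < t \<Longrightarrow> w k = w' k"
  shows "run G \<Phi> w s t x = run G \<Phi> w' s t x"
  unfolding run_def using assms by (intro fold_cong) auto

lemma dominating_refl: "dominating p m s s = m"
  by (simp add: dominating_def)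

lemma dominating_step:
  assumes "s \<le> t"
  shows "dominating p m s (t + 1) = patience_step (dominating p m s t) (p t)"
  using assms by (simp add: dominating_def upto_rec2)

text \<open>The key property of the one-step map, for every policy: it only ages items that were stored or have
  just arrived, and what survives has positive patience left.\<close>

lemma set_update_cases:
  assumes "a \<in> set (update G \<Phi> x z u)"
  shows "fst a > 0 \<and> (fst a + 1, snd a) \<in> insert z (set x)"
proof -
  define y where "y = (if has_match G x (snd z) then remove_at (\<Phi> x (snd z) u) x else x @ [z])"
  have "set y \<subseteq> insert z (set x)"
    by (auto simp: y_def remove_at_def dest: in_set_takeD in_set_dropD)
  moreover have "fst a > 0 \<and> (fst a + 1, snd a) \<in> set y"
    using assms by (auto simp: update_def y_def[symmetric] elapse_def)
  ultimately show ?thesis by auto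
qed

lemma run_patience_pos:
  assumes "s \<le> t" "\<forall>a\<in>set x. fst a > 0"
  shows "\<forall>a\<in>set (run G \<Phi> w s t x). fst a > 0"
  using assms(1)
proof (induction t rule: int_ge_induct)
  case base
  then show ?case using assms by (simp add: run_refl)
next
  case (step t)
  then show ?case by (auto simp: run_step dest: set_update_cases)
qed

text \<open>Induction along \<open>set_update_cases\<close>: matching only removes items, so the largest remaining
  patience never exceeds the one obtained by ignoring all matches.\<close>

lemma run_patience_le_dominating:
  assumes "s \<le> t" "\<forall>a\<in>set x. fst a \<le> m"
  shows "\<forall>a\<in>set (run G \<Phi> w s t x). fst a \<le> dominating (\<lambda>n. fst (fst (w n))) m s t"
  using assms(1)
proof (induction t rule: int_ge_induct)
  case base
  then show ?case using assms by (simp add: run_refl dominating_refl)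
next
  case (step t)
  show ?case
  proof
    fix a assume "a \<in> set (run G \<Phi> w s (t + 1) x)"
    then have "a \<in> set (update G \<Phi> (run G \<Phi> w s t x) (fst (w t)) (snd (w t)))"
      using step.hyps by (simp add: run_step)
    from set_update_cases[OF this]
    have "(fst a + 1, snd a) \<in> insert (fst (w t)) (set (run G \<Phi> w s t x))" ..
    then have "fst a + 1 \<le> max (dominating (\<lambda>n. fst (fst (w n))) m s t) (fst (fst (w t)))"
      using step.IH unfolding le_max_iff_disj by (metis fst_conv insertE order_refl)
    then show "fst a \<le> dominating (\<lambda>n. fst (fst (w n))) m s (t + 1)"
      using step.hyps by (simp add: dominating_step patience_step_def)
  qed
qed

text \<open>The bound \<open>m\<close> may be any bound for the initial profile, so the same lemma covers a regeneration
  reached from an arbitrary profile and a zero found by the sampler.\<close>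

lemma run_empty_if_dominating_nonpos:
  assumes "s \<le> t" "\<forall>a\<in>set x. 0 < fst a \<and> fst a \<le> m"
    and "dominating (\<lambda>n. fst (fst (w n))) m s t \<le> 0"
  shows "run G \<Phi> w s t x = []"
proof (rule ccontr)
  assume "run G \<Phi> w s t x \<noteq> []"
  then obtain a where "a \<in> set (run G \<Phi> w s t x)" by (meson last_in_set)
  then have "0 < fst a" "fst a \<le> dominating (\<lambda>n. fst (fst (w n))) m s t"
    using run_patience_pos[OF assms(1)] run_patience_le_dominating[OF assms(1)] assms(2) by blast+
  then show False using assms(3) by simp
qed

text \<open>If all patience granted before time \<open>i\<close> expires by time \<open>i\<close>, then at time \<open>t\<close> at most
  \<open>i - t\<close> is left; at \<open>t = i\<close> nothing is left.\<close>

lemma dominating_le_countdown: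
  assumes "s \<le> t" "t \<le> i" "m \<le> real_of_int (i - s)"
    and "\<And>k. s \<le> k \<Longrightarrow> k < i \<Longrightarrow> p k \<le> real_of_int (i - k)"
  shows "dominating p m s t \<le> real_of_int (i - t)"
  using assms(1,2)
proof (induction t rule: int_ge_induct)
  case base
  then show ?case using assms by (simp add: dominating_refl)
next
  case (step t)
  then have "dominating p m s t \<le> real_of_int (i - t)" "p t \<le> real_of_int (i - t)"
    using assms(4) by auto
  then show ?case
    using step.hyps step.prems by (simp add: dominating_step patience_step_def)
qed

lemma dominating_nonneg:
  assumes "s \<le> t" "0 \<le> m"
  shows "0 \<le> dominating p m s t"
  using assms(1)
  by (induction t rule: int_ge_induct)
    (simp_all add: assms(2) dominating_refl dominating_step patience_step_def)

lemma dominating_le_bound: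
  assumes "s \<le> t" "0 \<le> m" "\<And>k. p k \<le> m"
  shows "dominating p m s t \<le> m"
  using assms(1)
proof (induction t rule: int_ge_induct)
  case base
  then show ?case by (simp add: dominating_refl)
next
  case (step t)
  then show ?case
    using assms(2) assms(3)[of t] by (simp add: dominating_step patience_step_def)
qed

section \<open>Measurability on the profile space\<close>

lemma mem_set_Cons [simp]:
  "a # x \<in> set_Cons A X \<longleftrightarrow> a \<in> A \<and> x \<in> X" "[] \<notin> set_Cons A X"
  by (auto simp: set_Cons_def)

text \<open>Rectangles are handled through \<open>list_all2\<close>, for which taking, dropping and appending are
  already well supported.\<close>

lemma mem_listset: "x \<in> listset As \<longleftrightarrow> list_all2 (\<in>) x As"
  by (induction As arbitrary: x) (auto simp: set_Cons_def list_all2_Cons2)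

lemma take_lists: "As \<in> lists S \<Longrightarrow> take k As \<in> lists S"
  and drop_lists: "As \<in> lists S \<Longrightarrow> drop k As \<in> lists S"
  by (auto dest: in_set_takeD in_set_dropD)

abbreviation profiles :: "'v pair_pre_digraph \<Rightarrow> (real \<times> 'v) list set" where
  "profiles G \<equiv> lists (space (item_space G))"

lemma listset_subset_profiles:
  assumes "As \<in> lists (sets (item_space G))"
  shows "listset As \<subseteq> profiles G"
proof
  fix x assume "x \<in> listset As"
  then have "list_all2 (\<in>) x As" by (simp add: mem_listset)
  then show "x \<in> profiles G"
    using assms by (induction rule: list_all2_induct) (auto dest: sets.sets_into_space)
qed

lemma space_profile_space [simp]: "space (profile_space G) = profiles G"
  unfolding profile_space_def using listset_subset_profiles by (intro space_measure_of) blast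

lemma sets_profile_space:
  "sets (profile_space G) = sigma_sets (profiles G) (listset ` lists (sets (item_space G)))"
  unfolding profile_space_def using listset_subset_profiles by (intro sets_measure_of) blast

lemma listset_sets:
  assumes "As \<in> lists (sets (item_space G))"
  shows "listset As \<in> sets (profile_space G)"
  unfolding sets_profile_space using assms by (intro sigma_sets.Basic) auto

text \<open>It suffices to check preimages of rectangles, as these generate.\<close>

lemma measurable_profile_spaceI:
  assumes "\<And>w. w \<in> space M \<Longrightarrow> f w \<in> profiles G"
    and "\<And>As. As \<in> lists (sets (item_space G)) \<Longrightarrow> f -` listset As \<inter> space M \<in> sets M"
  shows "f \<in> M \<rightarrow>\<^sub>M profile_space G"
proof (rule measurable_sigma_sets[OF sets_profile_space])
  show "listset ` lists (sets (item_space G)) \<subseteq> Pow (profiles G)"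
    using listset_subset_profiles by blast
qed (use assms in auto)

lemma measurable_singleton_profile:
  "(\<lambda>a. [a]) \<in> item_space G \<rightarrow>\<^sub>M profile_space G"
proof (rule measurable_profile_spaceI)
  fix As assume As: "As \<in> lists (sets (item_space G))"
  consider A where "As = [A]" | "length As \<noteq> 1" by (cases As) (auto simp: length_Suc_conv)
  then show "(\<lambda>a. [a]) -` listset As \<inter> space (item_space G) \<in> sets (item_space G)"
  proof cases
    case 1
    then have "(\<lambda>a. [a]) -` listset As \<inter> space (item_space G) = A"
      using As by (auto simp: mem_listset simp del: listset.simps dest: sets.sets_into_space)
    then show ?thesis using 1 As by simp
  next
    case 2
    then have "(\<lambda>a. [a]) -` listset As = {}"
      by (auto simp: mem_listset simp del: split_paired_All dest!: list_all2_lengthD)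
    then show ?thesis by simp
  qed
qed auto

text \<open>A rectangle contains \<open>x @ y\<close> exactly if it splits at the position where \<open>x\<close> ends, and there
  are finitely many positions.\<close>

lemma measurable_append [measurable]:
  "(\<lambda>(x, y). x @ y) \<in> profile_space G \<Otimes>\<^sub>M profile_space G \<rightarrow>\<^sub>M profile_space G"
proof (rule measurable_profile_spaceI)
  fix As assume As: "As \<in> lists (sets (item_space G))"
  have "(\<lambda>(x, y). x @ y) -` listset As \<inter> space (profile_space G \<Otimes>\<^sub>M profile_space G) =
    (\<Union>k\<le>length As. listset (take k As) \<times> listset (drop k As))" (is "?L = ?R")
  proof (intro equalityI subsetI)
    fix w assume "w \<in> ?L"
    then obtain x y where w: "w = (x, y)" "list_all2 (\<in>) (x @ y) As"
      by (cases w) (auto simp: mem_listset)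
    then have "list_all2 (\<in>) x (take (length x) As)" "list_all2 (\<in>) y (drop (length x) As)"
      by (auto simp: list_all2_append1 dest: list_all2_lengthD)
    moreover have "length x \<le> length As" using w list_all2_lengthD by fastforce
    ultimately show "w \<in> ?R" by (auto simp: w mem_listset)
  next
    fix w assume "w \<in> ?R"
    then obtain k x y where w: "w = (x, y)"
      "x \<in> listset (take k As)" "y \<in> listset (drop k As)"
      by (cases w) auto
    have "list_all2 (\<in>) (x @ y) (take k As @ drop k As)"
      using w by (intro list_all2_appendI) (auto simp: mem_listset)
    moreover have "x \<in> profiles G" "y \<in> profiles G"
      using w As listset_subset_profiles[of "take k As" G] listset_subset_profiles[of "drop k As" G]
      by (auto dest: in_set_takeD in_set_dropD)
    ultimately show "w \<in> ?L" by (auto simp: w mem_listset space_pair_measure)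
  qed
  also have "\<dots> \<in> sets (profile_space G \<Otimes>\<^sub>M profile_space G)"
    using As by (intro sets.finite_UN pair_measureI listset_sets take_lists drop_lists) auto
  finally show "(\<lambda>(x, y). x @ y) -` listset As \<inter> space (profile_space G \<Otimes>\<^sub>M profile_space G)
    \<in> sets (profile_space G \<Otimes>\<^sub>M profile_space G)" .
qed (auto simp: space_pair_measure)

text \<open>Undoing the removal inserts an unconstrained factor at position \<open>k\<close>. Profiles too short to have
  a position \<open>k\<close> are left as they are, which gives the first part of the preimage.\<close>

lemma measurable_remove_at: "remove_at k \<in> profile_space G \<rightarrow>\<^sub>M profile_space G"
proof (rule measurable_profile_spaceI)
  fix As assume As: "As \<in> lists (sets (item_space G))"
  let ?I = "space (item_space G)"
  have "remove_at k -` listset As \<inter> space (profile_space G) =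
    (if length As \<le> k then listset As else {}) \<union>
    (if k \<le> length As then listset (take k As @ ?I # drop k As) else {})" (is "?L = ?R")
  proof (intro equalityI subsetI)
    fix x assume "x \<in> ?L"
    then have x: "x \<in> profiles G" "list_all2 (\<in>) (take k x @ drop (Suc k) x) As"
      by (auto simp: mem_listset remove_at_def)
    show "x \<in> ?R"
    proof (cases "length x \<le> k")
      case True
      then have "list_all2 (\<in>) x As" using x by simp
      then show ?thesis using True list_all2_lengthD[OF \<open>list_all2 (\<in>) x As\<close>]
        by (auto simp: mem_listset)
    next
      case False
      then have "list_all2 (\<in>) (take k x) (take k As)" "list_all2 (\<in>) (drop (Suc k) x) (drop k As)"
        using list_all2_takeI[OF x(2), of k] list_all2_dropI[OF x(2), of k] by simp_all
      moreover have "x ! k \<in> ?I" using x(1) False by auto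
      ultimately have "list_all2 (\<in>) (take k x @ x ! k # drop (Suc k) x) (take k As @ ?I # drop k As)"
        by (intro list_all2_appendI) auto
      then have "list_all2 (\<in>) x (take k As @ ?I # drop k As)"
        using False by (simp add: id_take_nth_drop[symmetric])
      moreover have "k \<le> length As" using list_all2_lengthD[OF x(2)] False by simp
      ultimately show ?thesis by (simp add: mem_listset)
    qed
  next
    fix x assume "x \<in> ?R"
    then consider "length As \<le> k" "x \<in> listset As"
      | "k \<le> length As" "x \<in> listset (take k As @ ?I # drop k As)"
      by (auto split: if_splits)
    then show "x \<in> ?L"
    proof cases
      case 1
      then have "length x \<le> k" by (auto simp: mem_listset dest: list_all2_lengthD)
      then show ?thesis using 1 listset_subset_profiles[OF As] by (auto simp: remove_at_def)
    next
      case 2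
      have "x \<in> profiles G"
        using 2 listset_subset_profiles[of "take k As @ ?I # drop k As" G] As
        by (auto simp: take_lists drop_lists simp del: in_lists_conv_set)
      moreover obtain y a z where "x = y @ a # z" "list_all2 (\<in>) y (take k As)"
        "list_all2 (\<in>) z (drop k As)"
        using 2(2) by (auto simp: mem_listset list_all2_append2 list_all2_Cons2)
      moreover from this have "length y = k" using 2 by (auto dest!: list_all2_lengthD)
      ultimately show ?thesis
        using list_all2_appendI[of "(\<in>)" y "take k As" z "drop k As"]
        by (auto simp: remove_at_def mem_listset)
    qed
  qed
  also have "\<dots> \<in> sets (profile_space G)"
    using As take_lists[OF As, of k] drop_lists[OF As, of k]
    by (intro sets.Un) (simp_all add: listset_sets del: in_lists_conv_set)
  finally show "remove_at k -` listset As \<inter> space (profile_space G) \<in> sets (profile_space G)" .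
qed (auto simp: remove_at_def dest: in_set_takeD in_set_dropD)


lemma hd_sets:
  assumes "B \<in> sets (item_space G)"
  shows "{x \<in> profiles G. x \<noteq> [] \<and> hd x \<in> B} \<in> sets (profile_space G)"
proof -
  have "{x \<in> profiles G. x \<noteq> [] \<and> hd x \<in> B} =
    (\<Union>q. listset (B # replicate q (space (item_space G))))" (is "?L = ?R")
  proof (intro equalityI subsetI)
    fix x assume "x \<in> ?L"
    then obtain a y where "x = a # y" "a \<in> B" "y \<in> profiles G" by (cases x) auto
    moreover from this have "list_all2 (\<in>) y (replicate (length y) (space (item_space G)))"
      by (auto simp: list_all2_conv_all_nth)
    ultimately have "x \<in> listset (B # replicate (length y) (space (item_space G)))"
      by (simp add: mem_listset del: listset.simps)
    then show "x \<in> ?R" by blast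
  next
    fix x assume "x \<in> ?R"
    then obtain q where q: "x \<in> listset (B # replicate q (space (item_space G)))" by blast
    moreover have "B # replicate q (space (item_space G)) \<in> lists (sets (item_space G))"
      using assms by auto
    with q have "x \<in> profiles G" using listset_subset_profiles by blast
    ultimately show "x \<in> ?L" by (auto simp: set_Cons_def)
  qed
  also have "\<dots> \<in> sets (profile_space G)"
    using assms by (intro sets.countable_UN image_subsetI listset_sets) auto
  finally show ?thesis .
qed

lemma in_set_tl: "a \<in> set (tl x) \<Longrightarrow> a \<in> set x"
  by (cases x) auto

lemma measurable_tl: "tl \<in> profile_space G \<rightarrow>\<^sub>M profile_space G"
proof (rule measurable_profile_spaceI)
  fix As assume As: "As \<in> lists (sets (item_space G))"
  have "tl -` listset As \<inter> space (profile_space G) =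
    listset (space (item_space G) # As) \<union> (if As = [] then listset [] else {})" (is "?L = ?R")
  proof (intro equalityI subsetI)
    fix x assume "x \<in> ?L"
    then show "x \<in> ?R" by (cases x) (auto simp: mem_listset simp del: listset.simps)
  next
    fix x assume x: "x \<in> ?R"
    then have "x \<in> profiles G"
      using listset_subset_profiles[of "space (item_space G) # As" G] As
      by (auto split: if_splits)
    then show "x \<in> ?L" using x
      by (cases x) (auto simp: mem_listset simp del: listset.simps split: if_splits)
  qed
  also have "\<dots> \<in> sets (profile_space G)"
    using As listset_sets[of "[]" G]
    by (intro sets.Un listset_sets) (auto simp del: listset.simps)
  finally show "tl -` listset As \<inter> space (profile_space G) \<in> sets (profile_space G)" .
qed (auto dest: in_set_tl)

text \<open>Together with induction on the length, this measurability of ``prepend a factor'' replaces an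
  identification of the profiles of length \<open>q\<close> with a \<open>q\<close>-fold product space.\<close>

lemma set_Cons_sets:
  assumes "B \<in> sets (item_space G)" "E \<in> sets (profile_space G)"
  shows "set_Cons B E \<in> sets (profile_space G)"
proof -
  have sub: "B \<subseteq> space (item_space G)" "E \<subseteq> profiles G"
    using sets.sets_into_space[OF assms(1)] sets.sets_into_space[OF assms(2)] by simp_all
  have "x \<in> set_Cons B E \<longleftrightarrow>
      x \<in> {x \<in> profiles G. x \<noteq> [] \<and> hd x \<in> B} \<inter> (tl -` E \<inter> space (profile_space G))" for x
  proof (cases x)
    case (Cons a y)
    have "a \<in> B \<Longrightarrow> a \<in> space (item_space G)" "y \<in> E \<Longrightarrow> y \<in> profiles G"
      using sub by blast+
    then show ?thesis by (auto simp: Cons simp del: in_lists_conv_set)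
  qed simp
  then have "set_Cons B E =
      {x \<in> profiles G. x \<noteq> [] \<and> hd x \<in> B} \<inter> (tl -` E \<inter> space (profile_space G))"
    by blast
  then show ?thesis
    using hd_sets[OF assms(1)] measurable_sets[OF measurable_tl assms(2)] by simp
qed

lemma nth_class_sets:
  "{x \<in> profiles G. k < length x \<and> snd (x ! k) \<in> C} \<in> sets (profile_space G)"
proof (induction k)
  case 0
  define B where "B = snd -` (C \<inter> pverts G) \<inter> space (item_space G)"
  have "B \<in> sets (item_space G)"
    unfolding B_def item_space_def by (rule measurable_sets[OF measurable_snd]) simp
  moreover have "a \<in> space (item_space G) \<Longrightarrow> a \<in> B \<longleftrightarrow> snd a \<in> C" for a
    by (cases a) (simp add: B_def item_space_def space_pair_measure)
  then have "x \<in> profiles G \<and> x \<noteq> [] \<and> hd x \<in> B \<longleftrightarrow>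
      x \<in> profiles G \<and> 0 < length x \<and> snd (x ! 0) \<in> C" for x
    by (cases x) (simp_all del: in_lists_conv_set, blast)
  ultimately show ?case using hd_sets[of B G] by simp
next
  case (Suc k)
  have "x \<in> tl -` {x \<in> profiles G. k < length x \<and> snd (x ! k) \<in> C} \<inter> profiles G \<longleftrightarrow>
      x \<in> {x \<in> profiles G. Suc k < length x \<and> snd (x ! Suc k) \<in> C}" for x
    by (cases x) (simp_all del: in_lists_conv_set, blast)
  then have "tl -` {x \<in> profiles G. k < length x \<and> snd (x ! k) \<in> C} \<inter> space (profile_space G) =
      {x \<in> profiles G. Suc k < length x \<and> snd (x ! Suc k) \<in> C}"
    unfolding space_profile_space by blast
  with measurable_sets[OF measurable_tl Suc] show ?case by simp
qed

lemma has_match_sets: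
  "{x \<in> space (profile_space G). has_match G x v} \<in> sets (profile_space G)"
proof -
  have "{x \<in> space (profile_space G). has_match G x v} =
    (\<Union>k. {x \<in> profiles G. k < length x \<and> snd (x ! k) \<in> {i. compatible G i v}})"
    by (auto simp: has_match_def)
  also have "\<dots> \<in> sets (profile_space G)"
    by (intro sets.countable_UN image_subsetI nth_class_sets)
  finally show ?thesis .
qed

text \<open>The value 1 is a dummy that keeps the map inside the item space.\<close>

definition age_item :: "real \<times> 'v \<Rightarrow> real \<times> 'v" where
  "age_item z = (if fst z > 1 then fst z - 1 else 1, snd z)"

lemma elapse_Nil: "elapse [] = []"
  and elapse_Cons: "elapse (z # x) = (if fst z > 1 then age_item z # elapse x else elapse x)"
  and elapse_append: "elapse (x @ y) = elapse x @ elapse y"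
  by (auto simp: elapse_def age_item_def split: prod.splits)

lemma measurable_age_item:
  assumes "fst \<in> borel_measurable M" "snd \<in> M \<rightarrow>\<^sub>M count_space (pverts G)"
  shows "age_item \<in> M \<rightarrow>\<^sub>M item_space G"
  unfolding item_space_def age_item_def
  using assms by (intro measurable_Pair measurable_restrict_space2) auto

lemma measurable_fst_item: "fst \<in> borel_measurable (item_space G)"
  and measurable_snd_item: "snd \<in> item_space G \<rightarrow>\<^sub>M count_space (pverts G)"
  unfolding item_space_def
  by (auto intro!: measurable_compose[OF measurable_fst measurable_restrict_space1])

lemma measurable_fst_mark: "fst \<in> borel_measurable (mark_space G)"
  and measurable_snd_mark: "snd \<in> mark_space G \<rightarrow>\<^sub>M count_space (pverts G)"
  unfolding mark_space_def
  by (auto intro!: measurable_compose[OF measurable_fst measurable_restrict_space1])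

text \<open>Fixing the length \<open>q\<close> allows induction: the first item either expires, and the rest must lie in
  the same rectangle, or it survives, and then its aged version uses up the first factor.\<close>

lemma elapse_vimage_sets:
  assumes "As \<in> lists (sets (item_space G))"
  shows "{x \<in> profiles G. length x = q \<and> elapse x \<in> listset As} \<in> sets (profile_space G)"
  using assms
proof (induction q arbitrary: As)
  case 0
  have "{x \<in> profiles G. length x = 0 \<and> elapse x \<in> listset As} = (if [] \<in> listset As then listset [] else {})"
    by (auto simp: elapse_Nil)
  then show ?case using listset_sets[of "[]" G] by simp
next
  case (Suc q)
  let ?I = "space (item_space G)"
  note [measurable] = measurable_fst_item
  define E where "E As = {x \<in> profiles G. length x = q \<and> elapse x \<in> listset As}" for As
  have long: "set_Cons {a \<in> ?I. \<not> fst a > 1} (E As) \<in> sets (profile_space G)"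
    using Suc by (intro set_Cons_sets) (auto simp: E_def)
  show ?case
  proof (cases As)
    case Nil
    have "x \<in> {x \<in> profiles G. length x = Suc q \<and> elapse x \<in> listset As} \<longleftrightarrow>
        x \<in> set_Cons {a \<in> ?I. \<not> fst a > 1} (E As)" for x
      by (cases x) (auto simp: E_def elapse_Cons Nil)
    then have eq: "{x \<in> profiles G. length x = Suc q \<and> elapse x \<in> listset As} =
        set_Cons {a \<in> ?I. \<not> fst a > 1} (E As)"
      by (intro set_eqI)
    show ?thesis unfolding eq by (rule long)
  next
    case (Cons A As')
    have A: "A \<in> sets (item_space G)" "As' \<in> lists (sets (item_space G))"
      using Suc.prems Cons by auto
    define B where "B = {a \<in> ?I. fst a > 1} \<inter> (age_item -` A \<inter> ?I)"
    have "age_item -` A \<inter> ?I \<in> sets (item_space G)"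
      using measurable_age_item[OF measurable_fst_item measurable_snd_item] A(1)
      by (rule measurable_sets)
    then have "B \<in> sets (item_space G)" unfolding B_def by (rule sets.Int[rotated]) simp
    then have surviving: "set_Cons B (E As') \<in> sets (profile_space G)"
      using Suc.IH[OF A(2)] unfolding E_def by (intro set_Cons_sets)
    have "x \<in> {x \<in> profiles G. length x = Suc q \<and> elapse x \<in> listset As} \<longleftrightarrow>
        x \<in> set_Cons {a \<in> ?I. \<not> fst a > 1} (E As) \<union> set_Cons B (E As')" for x
    proof (cases x)
      fix a y assume x: "x = a # y"
      show ?thesis
      proof (cases "fst a > 1")
        case True
        then have "elapse x \<in> listset As \<longleftrightarrow> age_item a \<in> A \<and> elapse y \<in> listset As'"
          by (simp add: x elapse_Cons Cons)
        then show ?thesis using True by (simp add: x E_def B_def del: in_lists_conv_set) blast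
      next
        case False
        then have "elapse x = elapse y" by (simp add: x elapse_Cons)
        then show ?thesis using False by (simp add: x E_def B_def del: in_lists_conv_set)
      qed
    qed simp
    then have eq: "{x \<in> profiles G. length x = Suc q \<and> elapse x \<in> listset As} =
        set_Cons {a \<in> ?I. \<not> fst a > 1} (E As) \<union> set_Cons B (E As')"
      by (intro set_eqI)
    show ?thesis unfolding eq by (rule sets.Un[OF long surviving])
  qed
qed

lemma elapse_profiles: "x \<in> profiles G \<Longrightarrow> elapse x \<in> profiles G"
proof (induction x)
  case (Cons a x)
  then have "a \<in> space (item_space G)" by simp
  with measurable_age_item[OF measurable_fst_item measurable_snd_item]
  have "age_item a \<in> space (item_space G)" by (rule measurable_space)
  then show ?case using Cons by (simp add: elapse_Cons del: in_lists_conv_set)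
qed (simp add: elapse_Nil)

lemma measurable_elapse: "elapse \<in> profile_space G \<rightarrow>\<^sub>M profile_space G"
proof (rule measurable_profile_spaceI)
  fix As assume As: "As \<in> lists (sets (item_space G))"
  have "elapse -` listset As \<inter> space (profile_space G) =
    (\<Union>q. {x \<in> profiles G. length x = q \<and> elapse x \<in> listset As})" by auto
  also have "\<dots> \<in> sets (profile_space G)"
    by (intro sets.countable_UN image_subsetI elapse_vimage_sets As)
  finally show "elapse -` listset As \<inter> space (profile_space G) \<in> sets (profile_space G)" .
qed (use elapse_profiles in auto)

lemma Nil_profiles: "[] \<in> space (profile_space G)"
  by simp

lemma measurable_elapse_mark: "(\<lambda>z. elapse [z]) \<in> mark_space G \<rightarrow>\<^sub>M profile_space G"
proof -
  note [measurable] = measurable_fst_mark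
  have "(\<lambda>z. if fst z > 1 then [age_item z] else []) \<in> mark_space G \<rightarrow>\<^sub>M profile_space G"
    by (intro measurable_If measurable_const Nil_profiles
        measurable_compose[OF measurable_age_item measurable_singleton_profile]
        measurable_fst_mark measurable_snd_mark) simp
  then show ?thesis by (simp add: elapse_Cons elapse_Nil cong: if_cong)
qed

text \<open>An arriving item may have patience 0, so that \<open>x @ [z]\<close> need not be a profile. Ageing is
  therefore applied to \<open>x\<close> and to \<open>[z]\<close> separately before appending. The class of the arrival
  and the position chosen by the policy take countably many values, which reduces joint measurability
  to that of the maps with these values fixed.\<close>

lemma measurable_update:
  assumes "countable (pverts G)" "admissible G D \<Phi>"
  shows "(\<lambda>(x, z, u). update G \<Phi> x z u) \<in>
    profile_space G \<Otimes>\<^sub>M (mark_space G \<Otimes>\<^sub>M D) \<rightarrow>\<^sub>M profile_space G" (is "_ \<in> ?M \<rightarrow>\<^sub>M _")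
proof -
  have x: "fst \<in> ?M \<rightarrow>\<^sub>M profile_space G" by simp
  have z: "(\<lambda>w. fst (snd w)) \<in> ?M \<rightarrow>\<^sub>M mark_space G" by simp
  have v: "(\<lambda>w. snd (fst (snd w))) \<in> ?M \<rightarrow>\<^sub>M count_space (pverts G)"
    by (rule measurable_compose[OF z measurable_snd_mark])
  have arguments: "(\<lambda>w. (fst w, snd (fst (snd w)), snd (snd w))) \<in>
    ?M \<rightarrow>\<^sub>M profile_space G \<Otimes>\<^sub>M (count_space (pverts G) \<Otimes>\<^sub>M D)"
    using v by (intro measurable_Pair) simp_all
  have "(\<lambda>(x, v, u). \<Phi> x v u) \<in>
    profile_space G \<Otimes>\<^sub>M (count_space (pverts G) \<Otimes>\<^sub>M D) \<rightarrow>\<^sub>M count_space UNIV"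
    using assms(2) by (simp add: admissible_def)
  from measurable_compose[OF arguments this] have k: "(\<lambda>w. \<Phi> (fst w) (snd (fst (snd w))) (snd (snd w))) \<in> ?M \<rightarrow>\<^sub>M count_space UNIV"
    by simp
  have removed: "(\<lambda>w. elapse (remove_at (\<Phi> (fst w) (snd (fst (snd w))) (snd (snd w))) (fst w)))
    \<in> ?M \<rightarrow>\<^sub>M profile_space G"
    by (rule measurable_compose[OF _ measurable_elapse])
      (rule measurable_compose_countable[OF measurable_compose[OF x measurable_remove_at] k])
  have "(\<lambda>w. (elapse (fst w), elapse [fst (snd w)])) \<in> ?M \<rightarrow>\<^sub>M profile_space G \<Otimes>\<^sub>M profile_space G"
    by (intro measurable_Pair measurable_compose[OF x measurable_elapse]
        measurable_compose[OF z measurable_elapse_mark])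
  from measurable_compose[OF this measurable_append]
  have stored: "(\<lambda>w. elapse (fst w) @ elapse [fst (snd w)]) \<in> ?M \<rightarrow>\<^sub>M profile_space G"
    by simp
  have "Measurable.pred ?M (\<lambda>w. has_match G (fst w) v)" for v
    by (rule measurable_compose[OF x]) (unfold pred_def, rule has_match_sets)
  then have "Measurable.pred ?M (\<lambda>w. has_match G (fst w) (snd (fst (snd w))))"
    by (rule measurable_compose_countable'[OF _ v assms(1)])
  then have "(\<lambda>w. if has_match G (fst w) (snd (fst (snd w)))
      then elapse (remove_at (\<Phi> (fst w) (snd (fst (snd w))) (snd (snd w))) (fst w))
      else elapse (fst w) @ elapse [fst (snd w)]) \<in> ?M \<rightarrow>\<^sub>M profile_space G"
    using removed stored by (intro measurable_If) (auto simp: pred_def)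
  moreover have "(if has_match G (fst w) (snd (fst (snd w)))
      then elapse (remove_at (\<Phi> (fst w) (snd (fst (snd w))) (snd (snd w))) (fst w))
      else elapse (fst w) @ elapse [fst (snd w)]) = (\<lambda>(x, z, u). update G \<Phi> x z u) w" for w
    by (cases w) (simp add: update_def elapse_append)
  ultimately show ?thesis by simp
qed

section \<open>Regeneration times\<close>

context prob_space
begin

context
  fixes X :: "nat \<Rightarrow> 'a \<Rightarrow> real"
  assumes indep: "indep_vars (\<lambda>_. borel) X UNIV"
    and distr_eq: "\<And>n. distr M borel (X n) = distr M borel (X 0)"
    and integrable: "integrable M (X 0)"
    and short: "prob {\<omega> \<in> space M. X 0 \<omega> \<le> 1} > 0"
begin

lemma measurable_X [measurable]: "X n \<in> borel_measurable M"
  using indep by (auto simp: indep_vars_def)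

lemma tail_prob_eq: "prob {\<omega> \<in> space M. X n \<omega> > a} = prob {\<omega> \<in> space M. X 0 \<omega> > a}"
proof -
  have "prob {\<omega> \<in> space M. X k \<omega> > a} = measure (distr M borel (X k)) {a<..}" for k
    by (subst measure_distr) (auto intro!: arg_cong[where f = prob])
  then show ?thesis using distr_eq[of n] by simp
qed

text \<open>The tail sum is bounded by the first absolute moment, because at most \<open>\<bar>X\<bar>\<close> of the numbers
  \<open>1, 2, 3, \<dots>\<close> lie below \<open>X\<close>.\<close>

lemma summable_tail_probs: "summable (\<lambda>k. prob {\<omega> \<in> space M. X 0 \<omega> > 1 + real k})"
proof (rule summableI_nonneg_bounded)
  fix n
  have "(\<Sum>k<n. prob {\<omega> \<in> space M. X 0 \<omega> > 1 + real k}) =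
      (\<integral>\<omega>. (\<Sum>k<n. indicator {\<omega> \<in> space M. X 0 \<omega> > 1 + real k} \<omega>) \<partial>M)"
    by (subst Bochner_Integration.integral_sum) (auto simp: Int_absorb2 emeasure_eq_measure)
  also have "\<dots> \<le> (\<integral>\<omega>. \<bar>X 0 \<omega>\<bar> \<partial>M)"
  proof (rule integral_mono)
    fix \<omega> assume \<omega>: "\<omega> \<in> space M"
    have "(\<Sum>k<n. indicator {\<omega> \<in> space M. X 0 \<omega> > 1 + real k} \<omega>) =
        real (card {k. k < n \<and> X 0 \<omega> > 1 + real k})"
      using \<omega> by (simp add: indicator_def sum.If_cases lessThan_def Collect_conj_eq)
    also have "\<dots> \<le> \<bar>X 0 \<omega>\<bar>"
    proof -
      have "{k. k < n \<and> X 0 \<omega> > 1 + real k} \<subseteq> {..<nat \<lfloor>\<bar>X 0 \<omega>\<bar>\<rfloor>}"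
      proof
        fix k assume "k \<in> {k. k < n \<and> X 0 \<omega> > 1 + real k}"
        then have "real_of_int (int k + 1) \<le> \<bar>X 0 \<omega>\<bar>" by simp
        then have "int k + 1 \<le> \<lfloor>\<bar>X 0 \<omega>\<bar>\<rfloor>" by (simp only: le_floor_iff)
        then show "k \<in> {..<nat \<lfloor>\<bar>X 0 \<omega>\<bar>\<rfloor>}" by simp
      qed
      from card_mono[OF _ this] have "card {k. k < n \<and> X 0 \<omega> > 1 + real k} \<le> nat \<lfloor>\<bar>X 0 \<omega>\<bar>\<rfloor>"
        by simp
      then show ?thesis by linarith
    qed
    finally show "(\<Sum>k<n. indicator {\<omega> \<in> space M. X 0 \<omega> > 1 + real k} \<omega>) \<le> \<bar>X 0 \<omega>\<bar>" .
  qed (use integrable in \<open>auto simp: emeasure_eq_measure intro!: Bochner_Integration.integrable_sum\<close>)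
  finally show "(\<Sum>k<n. prob {\<omega> \<in> space M. X 0 \<omega> > 1 + real k}) \<le> (\<integral>\<omega>. \<bar>X 0 \<omega>\<bar> \<partial>M)" .
qed simp

text \<open>From some \<open>N\<close> on the tail probabilities sum to less than \<open>1/2\<close>, so by Weierstrass's
  inequality the later factors contribute at least \<open>1/2\<close>; the first \<open>N\<close> factors are positive.\<close>

lemma tail_prods_bounded_below:
  "\<exists>c>0. \<exists>N. \<forall>n. c \<le> (\<Prod>k<N + n. 1 - prob {\<omega> \<in> space M. X 0 \<omega> > 1 + real k})"
proof -
  define e where "e k = prob {\<omega> \<in> space M. X 0 \<omega> > 1 + real k}" for k
  have e: "e k \<in> {0..1}" for k by (simp add: e_def)
  have e_less: "e k < 1" for k
  proof -
    have "e k \<le> prob {\<omega> \<in> space M. \<not> X 0 \<omega> \<le> 1}"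
      unfolding e_def by (intro finite_measure_mono) auto
    then show ?thesis using short by (simp add: prob_neg)
  qed
  have "summable e" unfolding e_def by (rule summable_tail_probs)
  from suminf_exist_split[OF _ this, of "1 / 2"]
  obtain N where N: "norm (\<Sum>i. e (i + N)) < 1 / 2" by auto
  \<comment> \<open>the first factors exactly, the others bounded by one half\<close>
  define c where "c = (\<Prod>k<N. 1 - e k) * (1 / 2)"
  have "c \<le> (\<Prod>k<N + n. 1 - e k)" for n
  proof -
    have "(\<Sum>i<n. e (i + N)) \<le> (\<Sum>i. e (i + N))"
      using e \<open>summable e\<close> by (intro sum_le_suminf summable_ignore_initial_segment) auto
    then have "1 / 2 \<le> 1 - (\<Sum>i<n. e (i + N))" using N by simp
    also have "\<dots> \<le> (\<Prod>i<n. 1 - e (i + N))"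
      using e by (intro Weierstrass_prod_ineq)
    finally have "c \<le> (\<Prod>k<N. 1 - e k) * (\<Prod>i<n. 1 - e (i + N))"
      unfolding c_def using e by (intro mult_left_mono prod_nonneg) auto
    also have "\<dots> = (\<Prod>k<N + n. 1 - e k)"
      by (induction n) (simp_all add: mult.assoc[symmetric] add.commute)
    finally show ?thesis .
  qed
  moreover have "c > 0" unfolding c_def using e_less by (auto intro!: prod_pos)
  ultimately show ?thesis unfolding e_def by blast
qed

text \<open>Read \<open>X j\<close> as the patience of the item arriving at time \<open>-1 - j\<close>. The event says that time
  \<open>-n\<close> is a regeneration time: all items that arrived before it have expired by then.\<close>

definition countdown :: "nat \<Rightarrow> 'a set" where
  "countdown n = {\<omega> \<in> space M. \<forall>j\<ge>n. X j \<omega> \<le> 1 + real j - real n}"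

lemma countdown_sets [measurable]: "countdown n \<in> events"
  unfolding countdown_def by measurable

text \<open>By independence and identical distribution, the finitely many constraints up to any index have a
  probability that is a partial product as above, independently of \<open>n\<close>; then let the index grow.\<close>

lemma countdown_prob_bounded_below: "\<exists>c>0. \<forall>n. c \<le> prob (countdown n)"
proof -
  obtain c N where c: "c > 0"
    "\<And>n. c \<le> (\<Prod>k<N + n. 1 - prob {\<omega> \<in> space M. X 0 \<omega> > 1 + real k})"
    using tail_prods_bounded_below by blast
  have "c \<le> prob (countdown n)" for n
  proof -
    define B where "B k = {\<omega> \<in> space M. \<forall>j<N + k. X (n + j) \<omega> \<le> 1 + real j}" for k
    have [measurable]: "B k \<in> events" for k unfolding B_def by measurable
    have "c \<le> prob (B k)" for k
    proof (cases "N + k = 0")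
      case True
      then show ?thesis using c(2)[of k] by (simp add: B_def prob_space)
    next
      case False
      have "prob (B k) = prob (\<Inter>i\<in>{n..<n + (N + k)}. X i -` {..1 + real (i - n)} \<inter> space M)"
      proof (rule arg_cong[where f = prob], intro equalityI subsetI)
        fix \<omega> assume "\<omega> \<in> B k"
        then have bound: "\<forall>j<N + k. X (n + j) \<omega> \<le> 1 + real j" unfolding B_def by simp
        have "X i \<omega> \<le> 1 + real (i - n)" if "i \<in> {n..<n + (N + k)}" for i
        proof -
          have "i - n < N + k" "n + (i - n) = i" using that by auto
          then show ?thesis using bound by metis
        qed
        with \<open>\<omega> \<in> B k\<close> show "\<omega> \<in> (\<Inter>i\<in>{n..<n + (N + k)}. X i -` {..1 + real (i - n)} \<inter> space M)"
          by (auto simp: B_def)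
      next
        fix \<omega> assume \<omega>: "\<omega> \<in> (\<Inter>i\<in>{n..<n + (N + k)}. X i -` {..1 + real (i - n)} \<inter> space M)"
        have "X (n + j) \<omega> \<le> 1 + real j" if "j < N + k" for j
          using INT_D[OF \<omega>, of "n + j"] that by simp
        moreover have "\<omega> \<in> space M" using INT_D[OF \<omega>, of n] False by simp
        ultimately show "\<omega> \<in> B k" by (simp add: B_def)
      qed
      also have "\<dots> = (\<Prod>i\<in>{n..<n + (N + k)}. prob (X i -` {..1 + real (i - n)} \<inter> space M))"
        using False by (intro indep_varsD[OF indep]) auto
      also have "\<dots> = (\<Prod>j<N + k. prob (X (j + n) -` {..1 + real j} \<inter> space M))"
        using prod.shift_bounds_nat_ivl[of "\<lambda>i. prob (X i -` {..1 + real (i - n)} \<inter> space M)" 0 n "N + k"]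
        by (simp add: lessThan_atLeast0 add.commute)
      also have "\<dots> = (\<Prod>j<N + k. 1 - prob {\<omega> \<in> space M. X 0 \<omega> > 1 + real j})"
      proof (rule prod.cong[OF refl])
        fix j
        have "X (j + n) -` {..1 + real j} \<inter> space M = {\<omega> \<in> space M. \<not> X (j + n) \<omega> > 1 + real j}"
          by auto
        then show "prob (X (j + n) -` {..1 + real j} \<inter> space M) =
            1 - prob {\<omega> \<in> space M. X 0 \<omega> > 1 + real j}"
          using tail_prob_eq[of "1 + real j" "j + n"] prob_neg[of "\<lambda>\<omega>. X (j + n) \<omega> > 1 + real j"]
          by simp
      qed
      finally show ?thesis using c(2)[of k] by simp
    qed
    moreover have "(\<lambda>k. prob (B k)) \<longlonglongrightarrow> prob (\<Inter>k. B k)"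
      by (rule finite_Lim_measure_decseq) (auto simp: decseq_def B_def)
    moreover have "(\<Inter>k. B k) = countdown n"
    proof (intro equalityI subsetI)
      fix \<omega> assume \<omega>: "\<omega> \<in> (\<Inter>k. B k)"
      have "X j \<omega> \<le> 1 + real j - real n" if "n \<le> j" for j
      proof -
        have "\<omega> \<in> B (Suc (j - n))" using \<omega> by blast
        then have "X (n + (j - n)) \<omega> \<le> 1 + real (j - n)" unfolding B_def by simp
        then show ?thesis using that by (simp add: of_nat_diff)
      qed
      then show "\<omega> \<in> countdown n" using \<omega> by (auto simp: countdown_def B_def)
    next
      fix \<omega> assume \<omega>: "\<omega> \<in> countdown n"
      then have bound: "\<forall>j\<ge>n. X j \<omega> \<le> 1 + real j - real n" by (simp add: countdown_def)
      have "X (n + j) \<omega> \<le> 1 + real j" for j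
        using bound[rule_format, of "n + j"] by simp
      then show "\<omega> \<in> (\<Inter>k. B k)" using \<omega> by (simp add: B_def countdown_def)
    qed
    ultimately show ?thesis by (intro LIMSEQ_le_const[of _ _ c]) auto
  qed
  with c(1) show ?thesis by blast
qed

text \<open>The event \<open>countdown i\<close> only involves the variables from index \<open>i\<close> on, so dropping finitely many
  of these events from the limit superior leaves only variables of large index.\<close>

lemma countdown_tail_event:
  "(\<Inter>n. \<Union>i\<in>{n..}. countdown i) \<in>
    tail_events (\<lambda>j. sigma_sets (space M) {X j -` B \<inter> space M |B. B \<in> sets borel})"
  (is "?E \<in> tail_events ?A")
  unfolding tail_events_def
proof
  fix n :: nat
  let ?N = "sigma (space M) (\<Union>j\<in>{n..}. ?A j)"
  have sub: "(\<Union>j\<in>{n..}. ?A j) \<subseteq> Pow (space M)"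
    by (auto dest: sigma_sets_into_sp[rotated])
  have sets: "sets ?N = sigma_sets (space M) (\<Union>j\<in>{n..}. ?A j)" and space: "space ?N = space M"
    using sub by (simp_all add: sets_measure_of)
  have X: "X j \<in> borel_measurable ?N" if "j \<ge> n" for j
  proof (rule measurableI)
    fix B :: "real set" assume "B \<in> sets borel"
    then have "X j -` B \<inter> space M \<in> ?A j" by auto
    then show "X j -` B \<inter> space ?N \<in> sets ?N"
      unfolding sets space using that by (intro sigma_sets.Basic) blast
  qed simp
  have countdown: "countdown i \<in> sets ?N" if "i \<ge> n" for i
  proof -
    have "Measurable.pred ?N (\<lambda>\<omega>. \<forall>j. j \<ge> i \<longrightarrow> X j \<omega> \<le> 1 + real j - real i)"
    proof (rule pred_intros_countable)
      fix j
      show "Measurable.pred ?N (\<lambda>\<omega>. j \<ge> i \<longrightarrow> X j \<omega> \<le> 1 + real j - real i)"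
      proof (cases "j \<ge> i")
        case True
        have [measurable]: "X j \<in> borel_measurable ?N" using order_trans[OF that True] by (rule X)
        show ?thesis using True by simp
      qed simp
    qed
    then show ?thesis unfolding countdown_def pred_def space .
  qed
  have "?E = (\<Inter>m\<in>{n..}. \<Union>i\<in>{m..}. countdown i)"
  proof (intro equalityI subsetI INT_I)
    fix \<omega> m assume \<omega>: "\<omega> \<in> (\<Inter>m\<in>{n..}. \<Union>i\<in>{m..}. countdown i)"
    then obtain i where "i \<ge> max m n" "\<omega> \<in> countdown i"
      by (metis INT_E UN_E atLeast_iff max.cobounded2)
    then show "\<omega> \<in> (\<Union>i\<in>{m..}. countdown i)" by auto
  qed blast
  also have "\<dots> \<in> sets ?N"
    using countdown by (intro sets.countable_INT'' sets.countable_INT' sets.countable_UN'') auto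
  finally show "?E \<in> sigma_sets (space M) (\<Union>j\<in>{n..}. ?A j)" unfolding sets .
qed

text \<open>A single regeneration need not occur with probability 1 at a fixed time, and different times are
  dependent; the zero-one law applied to infinitely many occurrences circumvents this.\<close>

lemma AE_ex_countdown: "AE \<omega> in M. \<exists>n. \<forall>j\<ge>n. X j \<omega> \<le> 1 + real j - real n"
proof -
  let ?A = "\<lambda>j. sigma_sets (space M) {X j -` B \<inter> space M |B. B \<in> sets borel}"
  let ?U = "\<lambda>n. \<Union>i\<in>{n..}. countdown i"
  have "prob (\<Inter>n. ?U n) = 0 \<or> prob (\<Inter>n. ?U n) = 1"
  proof (rule kolmogorov_0_1_law[OF _ _ countdown_tail_event])
    show "sigma_algebra (space M) (?A j)" for j
      by (rule sigma_algebra_sigma_sets) auto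
    show "indep_sets ?A UNIV" using indep by (simp add: indep_vars_def)
  qed
  moreover have "prob (\<Inter>n. ?U n) > 0"
  proof -
    obtain c where c: "c > 0" "\<And>n. c \<le> prob (countdown n)"
      using countdown_prob_bounded_below by blast
    have "c \<le> prob (?U n)" for n
      using c(2)[of n] by (rule order_trans) (intro finite_measure_mono; auto)
    moreover have "(\<lambda>n. prob (?U n)) \<longlonglongrightarrow> prob (\<Inter>n. ?U n)"
    proof (rule finite_Lim_measure_decseq)
      show "decseq ?U" by (intro decseq_SucI UN_mono) auto
    qed auto
    ultimately have "c \<le> prob (\<Inter>n. ?U n)" by (intro LIMSEQ_le_const[of _ _ c]) auto
    with c(1) show ?thesis by simp
  qed
  ultimately have "prob (\<Inter>n. ?U n) = 1" by linarith
  then have "AE \<omega> in M. \<omega> \<in> (\<Inter>n. ?U n)" by (simp add: prob_eq_1)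
  then show ?thesis by eventually_elim (auto simp: countdown_def)
qed

end

end

section \<open>The profile chain as iterated random maps\<close>

locale matching_chain =
  fixes G :: "'v pair_pre_digraph"
    and D :: "'u measure"
    and \<Phi> :: "(real \<times> 'v) list \<Rightarrow> 'v \<Rightarrow> 'u \<Rightarrow> nat"
    and \<mu> :: "(real \<times> 'v) measure"
  assumes countable_classes: "countable (pverts G)"
    and draw_law: "prob_space D"
    and policy: "admissible G D \<Phi>"
    and mark_law: "prob_space \<mu>" "sets \<mu> = sets (mark_space G)"
begin

abbreviation "S \<equiv> profile_space G"
abbreviation "\<nu> \<equiv> \<mu> \<Otimes>\<^sub>M D"
abbreviation "K \<equiv> profile_kernel G \<Phi> \<mu> D"

sublocale draw: prob_space D by (rule draw_law)
sublocale mark: prob_space \<mu> by (rule mark_law)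
sublocale input: pair_prob_space \<mu> D ..

lemma measurable_step [measurable]:
  "(\<lambda>(x, z). update G \<Phi> x (fst z) (snd z)) \<in> S \<Otimes>\<^sub>M \<nu> \<rightarrow>\<^sub>M S"
proof -
  have "sets (S \<Otimes>\<^sub>M \<nu>) = sets (S \<Otimes>\<^sub>M (mark_space G \<Otimes>\<^sub>M D))"
    by (intro sets_pair_measure_cong mark_law(2) refl)
  from measurable_cong_sets[OF this refl[of "sets S"]] show ?thesis
    using measurable_update[OF countable_classes policy] unfolding case_prod_unfold by blast
qed

lemma kernel_eq: "K x = distr \<nu> S (\<lambda>z. update G \<Phi> x (fst z) (snd z))"
  by (simp add: profile_kernel_def case_prod_unfold)

lemma measurable_kernel [measurable]: "K \<in> S \<rightarrow>\<^sub>M subprob_algebra S"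
proof -
  have "(\<lambda>x. distr \<nu> S (\<lambda>z. update G \<Phi> x (fst z) (snd z))) \<in> S \<rightarrow>\<^sub>M subprob_algebra S"
    using measurable_step input.subprob_space_axioms
    by (intro measurable_distr2[where M = \<nu>] measurable_const) (simp_all add: space_subprob_algebra)
  then show ?thesis unfolding kernel_eq[abs_def] .
qed

lemma prob_space_kernel:
  assumes "x \<in> space S"
  shows "prob_space (K x)"
proof -
  have "(\<lambda>z. (x, z)) \<in> \<nu> \<rightarrow>\<^sub>M S \<Otimes>\<^sub>M \<nu>" using assms by (intro measurable_Pair1')
  from measurable_compose[OF this measurable_step] show ?thesis
    unfolding kernel_eq by (intro input.prob_space_distr) simp
qed

lemma space_S_not_empty: "space S \<noteq> {}"
  using Nil_profiles by blast

text \<open>Stated with the Giry monad, stationarity is a fixed-point equation, and iterating it is an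
  application of associativity.\<close>

lemma stationary_iff_bind:
  "stationary_distribution S K \<pi> \<longleftrightarrow> prob_space \<pi> \<and> sets \<pi> = sets S \<and> \<pi> \<bind> K = \<pi>"
proof (cases "sets \<pi> = sets S")
  case True
  then have nonempty: "space \<pi> \<noteq> {}" using space_S_not_empty sets_eq_imp_space_eq by metis
  have K: "K \<in> \<pi> \<rightarrow>\<^sub>M subprob_algebra S"
    using measurable_kernel measurable_cong_sets[OF True refl] by blast
  have "sets (\<pi> \<bind> K) = sets S"
    by (rule sets_bind[OF sets_kernel[OF K] nonempty])
  then have bind: "\<pi> \<bind> K = \<pi> \<longleftrightarrow> (\<forall>A\<in>sets S. emeasure (\<pi> \<bind> K) A = emeasure \<pi> A)"
    using True by (auto intro: measure_eqI)
  have "(emeasure (\<pi> \<bind> K) A = emeasure \<pi> A) = (emeasure \<pi> A = (\<integral>\<^sup>+ x. emeasure (K x) A \<partial>\<pi>))"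
    if "A \<in> sets S" for A
    using emeasure_bind[OF nonempty K that] by (simp only: eq_commute)
  then show ?thesis
    unfolding stationary_distribution_def bind using True by (simp only: cong: ball_cong)
qed (simp add: stationary_distribution_def)

text \<open>One step from a random profile with law \<open>L\<close>, driven by an independent input, has the law obtained
  from the kernel. This is where independence enters the law of a run.\<close>

lemma distr_step_eq_bind:
  assumes "prob_space L" "sets L = sets S"
  shows "distr (L \<Otimes>\<^sub>M \<nu>) S (\<lambda>(x, z). update G \<Phi> x (fst z) (snd z)) = L \<bind> K"
proof -
  interpret L: prob_space L by fact
  interpret LN: pair_prob_space L \<nu> ..
  have LN_sets: "sets (L \<Otimes>\<^sub>M \<nu>) = sets (S \<Otimes>\<^sub>M \<nu>)"
    by (intro sets_pair_measure_cong assms refl)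
  have step: "(\<lambda>(x, z). update G \<Phi> x (fst z) (snd z)) \<in> L \<Otimes>\<^sub>M \<nu> \<rightarrow>\<^sub>M S"
    using measurable_step measurable_cong_sets[OF LN_sets refl] by blast
  have K: "K \<in> L \<rightarrow>\<^sub>M subprob_algebra S"
    using measurable_kernel measurable_cong_sets[OF assms(2) refl] by blast
  show ?thesis
  proof (rule measure_eqI)
    show "sets (distr (L \<Otimes>\<^sub>M \<nu>) S (\<lambda>(x, z). update G \<Phi> x (fst z) (snd z))) = sets (L \<bind> K)"
      using sets_bind[OF sets_kernel[OF K] L.not_empty] by simp
    fix A assume "A \<in> sets (distr (L \<Otimes>\<^sub>M \<nu>) S (\<lambda>(x, z). update G \<Phi> x (fst z) (snd z)))"
    then have A: "A \<in> sets S" by simp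
    have "emeasure (distr (L \<Otimes>\<^sub>M \<nu>) S (\<lambda>(x, z). update G \<Phi> x (fst z) (snd z))) A =
      (\<integral>\<^sup>+x. emeasure \<nu> (Pair x -` ((\<lambda>(x, z). update G \<Phi> x (fst z) (snd z)) -` A \<inter> space (L \<Otimes>\<^sub>M \<nu>))) \<partial>L)"
      using step A by (simp add: emeasure_distr input.emeasure_pair_measure_alt measurable_sets)
    also have "\<dots> = (\<integral>\<^sup>+x. emeasure (K x) A \<partial>L)"
    proof (rule nn_integral_cong)
      fix x assume x: "x \<in> space L"
      have "(\<lambda>z. (x, z)) \<in> \<nu> \<rightarrow>\<^sub>M L \<Otimes>\<^sub>M \<nu>" using x by (intro measurable_Pair1')
      from measurable_compose[OF this step]
      have "(\<lambda>z. update G \<Phi> x (fst z) (snd z)) \<in> \<nu> \<rightarrow>\<^sub>M S" by simp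
      moreover have "Pair x -` ((\<lambda>(x, z). update G \<Phi> x (fst z) (snd z)) -` A \<inter> space (L \<Otimes>\<^sub>M \<nu>)) =
        (\<lambda>z. update G \<Phi> x (fst z) (snd z)) -` A \<inter> space \<nu>"
        using x by (auto simp: space_pair_measure)
      ultimately show "emeasure \<nu> (Pair x -` ((\<lambda>(x, z). update G \<Phi> x (fst z) (snd z)) -` A \<inter> space (L \<Otimes>\<^sub>M \<nu>)))
        = emeasure (K x) A"
        using A by (simp add: kernel_eq emeasure_distr)
    qed
    also have "\<dots> = emeasure (L \<bind> K) A"
      by (rule emeasure_bind[OF L.not_empty K A, symmetric])
    finally show "emeasure (distr (L \<Otimes>\<^sub>M \<nu>) S (\<lambda>(x, z). update G \<Phi> x (fst z) (snd z))) A =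
      emeasure (L \<bind> K) A" .
  qed
qed

text \<open>The \<open>n\<close>-step transition kernel.\<close>

primrec law :: "nat \<Rightarrow> (real \<times> 'v) list \<Rightarrow> (real \<times> 'v) list measure" where
  "law 0 x = return S x"
| "law (Suc n) x = law n x \<bind> K"

lemma measurable_law [measurable]: "law n \<in> S \<rightarrow>\<^sub>M subprob_algebra S"
proof (induction n)
  case 0
  then show ?case using return_measurable[of S] by (simp add: cong: measurable_cong)
next
  case (Suc n)
  then show ?case using measurable_bind2[OF Suc measurable_kernel] by (simp cong: measurable_cong)
qed

lemma stationary_bind_law:
  assumes "stationary_distribution S K \<pi>"
  shows "\<pi> \<bind> law n = \<pi>"
proof (induction n)
  have sets: "sets \<pi> = sets S" and K: "\<pi> \<bind> K = \<pi>"
    using assms by (auto simp: stationary_iff_bind)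
  case 0
  have "\<pi> \<bind> return \<pi> = \<pi>" by (rule bind_return')
  moreover have "return \<pi> = return S" using sets by (intro ext return_cong)
  moreover have "law 0 = return S" by (simp add: fun_eq_iff)
  ultimately show ?case by simp
next
  have sets: "sets \<pi> = sets S" and K: "\<pi> \<bind> K = \<pi>"
    using assms by (auto simp: stationary_iff_bind)
  case (Suc n)
  have "law n \<in> \<pi> \<rightarrow>\<^sub>M subprob_algebra S"
    using measurable_law measurable_cong_sets[OF sets refl] by blast
  moreover have "law (Suc n) = (\<lambda>x. law n x \<bind> K)" by (simp add: fun_eq_iff)
  ultimately have "\<pi> \<bind> law (Suc n) = (\<pi> \<bind> law n) \<bind> K"
    by (simp only: bind_assoc[OF _ measurable_kernel])
  then show ?case by (simp only: Suc K)
qed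

lemma measurable_run:
  assumes "x \<in> space S" "s \<le> t" "{s..<t} \<subseteq> I"
  shows "(\<lambda>w. run G \<Phi> w s t x) \<in> PiM I (\<lambda>_. \<nu>) \<rightarrow>\<^sub>M S"
  using assms(2,3)
proof (induction t rule: int_ge_induct)
  case base
  then show ?case using assms(1) by (simp add: run_refl)
next
  case (step t)
  have "{s..<t} \<subseteq> {s..<t + 1}" by auto
  then have "{s..<t} \<subseteq> I" using step.prems by (rule order_trans)
  then have "(\<lambda>w. run G \<Phi> w s t x) \<in> PiM I (\<lambda>_. \<nu>) \<rightarrow>\<^sub>M S" by (rule step.IH)
  moreover have "(\<lambda>w. w t) \<in> PiM I (\<lambda>_. \<nu>) \<rightarrow>\<^sub>M \<nu>"
    using step.hyps step.prems by (intro measurable_component_singleton) auto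
  ultimately have "(\<lambda>w. (run G \<Phi> w s t x, w t)) \<in> PiM I (\<lambda>_. \<nu>) \<rightarrow>\<^sub>M S \<Otimes>\<^sub>M \<nu>"
    by (rule measurable_Pair)
  from measurable_compose[OF this measurable_step] show ?case
    by (simp only: run_step[OF step.hyps] prod.case)
qed

end

text \<open>The chain is realised on one probability space by a doubly infinite sequence of inputs (mark and
  draw), so that runs from all starting times and profiles are coupled.\<close>

locale driven_matching_chain = matching_chain G D \<Phi> \<mu> + \<Omega>: prob_space \<Omega>
  for G :: "'v pair_pre_digraph"
    and D :: "'u measure"
    and \<Phi> :: "(real \<times> 'v) list \<Rightarrow> 'v \<Rightarrow> 'u \<Rightarrow> nat"
    and \<mu> :: "(real \<times> 'v) measure"
    and \<Omega> :: "'w measure" +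
  fixes W :: "int \<Rightarrow> 'w \<Rightarrow> (real \<times> 'v) \<times> 'u"
  assumes indep_inputs: "\<Omega>.indep_vars (\<lambda>_. \<mu> \<Otimes>\<^sub>M D) W UNIV"
    and distr_input: "distr \<Omega> (\<mu> \<Otimes>\<^sub>M D) (W n) = \<mu> \<Otimes>\<^sub>M D"
begin

abbreviation path :: "int \<Rightarrow> int \<Rightarrow> (real \<times> 'v) list \<Rightarrow> 'w \<Rightarrow> (real \<times> 'v) list" where
  "path s t x \<omega> \<equiv> run G \<Phi> (\<lambda>n. W n \<omega>) s t x"

lemma measurable_input [measurable]: "W n \<in> \<Omega> \<rightarrow>\<^sub>M \<nu>"
  using indep_inputs by (auto simp: \<Omega>.indep_vars_def)

lemma measurable_path [measurable]:
  assumes "x \<in> space S" "s \<le> t"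
  shows "path s t x \<in> \<Omega> \<rightarrow>\<^sub>M S"
proof -
  have "(\<lambda>\<omega>. \<lambda>n\<in>{s..<t}. W n \<omega>) \<in> \<Omega> \<rightarrow>\<^sub>M PiM {s..<t} (\<lambda>_. \<nu>)"
    by (intro measurable_restrict measurable_input)
  from measurable_compose[OF this measurable_run[OF assms order_refl]]
  have "(\<lambda>\<omega>. run G \<Phi> (\<lambda>n\<in>{s..<t}. W n \<omega>) s t x) \<in> \<Omega> \<rightarrow>\<^sub>M S" .
  also have "(\<lambda>\<omega>. run G \<Phi> (\<lambda>n\<in>{s..<t}. W n \<omega>) s t x) = path s t x"
    by (intro ext run_cong) auto
  finally show ?thesis .
qed

text \<open>The profile at time \<open>t\<close> is a function of the inputs at times \<open>s, \<dots>, t - 1\<close>. Since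
  \<open>indep_var\<close> relates variables with values in one type, independence is first used for the
  restrictions of the input sequence to \<open>{s..<t}\<close> and to \<open>{t}\<close>, and the product law is
  then mapped to the profile and the input.\<close>

lemma joint_law_path_input:
  assumes "x \<in> space S" "s \<le> t"
  shows "distr \<Omega> (S \<Otimes>\<^sub>M \<nu>) (\<lambda>\<omega>. (path s t x \<omega>, W t \<omega>)) = distr \<Omega> S (path s t x) \<Otimes>\<^sub>M \<nu>"
proof -
  let ?PA = "PiM {s..<t} (\<lambda>_. \<nu>)" and ?PB = "PiM {t} (\<lambda>_. \<nu>)"
  let ?A = "\<lambda>\<omega>. \<lambda>n\<in>{s..<t}. W n \<omega>" and ?B = "\<lambda>\<omega>. \<lambda>n\<in>{t}. W n \<omega>"
  let ?f = "\<lambda>w. run G \<Phi> w s t x" and ?g = "\<lambda>w. w t"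
  have [measurable]: "?A \<in> \<Omega> \<rightarrow>\<^sub>M ?PA" "?B \<in> \<Omega> \<rightarrow>\<^sub>M ?PB"
    by (intro measurable_restrict measurable_input)+
  have [measurable]: "?f \<in> ?PA \<rightarrow>\<^sub>M S" using assms by (intro measurable_run) auto
  have [measurable]: "?g \<in> ?PB \<rightarrow>\<^sub>M \<nu>" by (intro measurable_component_singleton) simp
  have "\<Omega>.indep_var ?PA ?A ?PB ?B"
    by (rule \<Omega>.indep_var_restrict[OF indep_inputs]) auto
  then have joint: "distr \<Omega> ?PA ?A \<Otimes>\<^sub>M distr \<Omega> ?PB ?B = distr \<Omega> (?PA \<Otimes>\<^sub>M ?PB) (\<lambda>\<omega>. (?A \<omega>, ?B \<omega>))"
    by (simp add: \<Omega>.indep_var_distribution_eq)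
  have f: "?f (?A \<omega>) = path s t x \<omega>" for \<omega> by (intro run_cong) auto
  have \<nu>: "distr (distr \<Omega> ?PB ?B) \<nu> ?g = \<nu>"
    by (simp add: distr_distr comp_def distr_input)
  have "distr \<Omega> S (path s t x) \<Otimes>\<^sub>M \<nu> =
      distr (distr \<Omega> ?PA ?A) S ?f \<Otimes>\<^sub>M distr (distr \<Omega> ?PB ?B) \<nu> ?g"
    unfolding \<nu> by (simp add: distr_distr comp_def f)
  also have "\<dots> = distr (distr \<Omega> ?PA ?A \<Otimes>\<^sub>M distr \<Omega> ?PB ?B) (S \<Otimes>\<^sub>M \<nu>) (\<lambda>(w, w'). (?f w, ?g w'))"
    by (rule pair_measure_distr) (simp_all add: \<nu> input.sigma_finite_measure_axioms)
  also have "\<dots> = distr \<Omega> (S \<Otimes>\<^sub>M \<nu>) (\<lambda>\<omega>. (path s t x \<omega>, W t \<omega>))"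
    unfolding joint by (simp add: distr_distr comp_def f)
  finally show ?thesis ..
qed

lemma distr_path:
  assumes "x \<in> space S" "s \<le> t"
  shows "distr \<Omega> S (path s t x) = law (nat (t - s)) x"
  using assms(2)
proof (induction t rule: int_ge_induct)
  case base
  have "path s s x = (\<lambda>_. x)" by (simp add: run_refl fun_eq_iff)
  then show ?case using \<Omega>.distr_const[OF assms(1)] by simp
next
  case (step t)
  let ?L = "law (nat (t - s)) x"
  let ?step = "\<lambda>(x, z). update G \<Phi> x (fst z) (snd z)"
  have L: "distr \<Omega> S (path s t x) = ?L" by fact
  have [measurable]: "path s t x \<in> \<Omega> \<rightarrow>\<^sub>M S" using assms(1) step.hyps by (rule measurable_path)
  have L_prob: "prob_space ?L" "sets ?L = sets S"
    unfolding L[symmetric] by (simp_all add: \<Omega>.prob_space_distr)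
  have joint: "distr \<Omega> (S \<Otimes>\<^sub>M \<nu>) (\<lambda>\<omega>. (path s t x \<omega>, W t \<omega>)) = ?L \<Otimes>\<^sub>M \<nu>"
    using joint_law_path_input[OF assms(1) step.hyps] by (simp add: L)
  have next_path: "path s (t + 1) x = (\<lambda>\<omega>. ?step (path s t x \<omega>, W t \<omega>))"
    by (intro ext) (simp only: run_step[OF step.hyps] prod.case)
  have pair: "(\<lambda>\<omega>. (path s t x \<omega>, W t \<omega>)) \<in> \<Omega> \<rightarrow>\<^sub>M S \<Otimes>\<^sub>M \<nu>" by measurable
  have "distr \<Omega> S (path s (t + 1) x) =
      distr (distr \<Omega> (S \<Otimes>\<^sub>M \<nu>) (\<lambda>\<omega>. (path s t x \<omega>, W t \<omega>))) S ?step"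
    unfolding distr_distr[OF measurable_step pair] comp_def next_path ..
  also have "\<dots> = distr (?L \<Otimes>\<^sub>M \<nu>) S ?step" by (simp only: joint)
  also have "\<dots> = ?L \<bind> K" by (rule distr_step_eq_bind[OF L_prob])
  also have "\<dots> = law (nat (t + 1 - s)) x"
  proof -
    have "nat (t + 1 - s) = Suc (nat (t - s))"
      using step.hyps by (simp add: Suc_nat_eq_nat_zadd1 algebra_simps)
    then have "law (nat (t + 1 - s)) x = law (Suc (nat (t - s))) x" by (rule arg_cong)
    then show ?thesis unfolding law.simps by (rule sym)
  qed
  finally show ?case .
qed

text \<open>If the runs from every profile eventually agree with \<open>X\<close>, dominated convergence gives convergence
  of the \<open>n\<close>-step laws, for integrals of bounded functions and from every initial profile. Applied to
  \<open>y \<mapsto> K y A\<close> it shows invariance of the law of \<open>X\<close>; applied to indicators and integrated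
  against \<open>\<pi>\<close> it shows uniqueness.\<close>

theorem coupling_from_the_past:
  assumes X [measurable]: "X \<in> \<Omega> \<rightarrow>\<^sub>M S"
    and coupling: "\<And>x. x \<in> space S \<Longrightarrow> AE \<omega> in \<Omega>. \<exists>N. \<forall>n\<ge>N. path (- int n) 0 x \<omega> = X \<omega>"
  shows "stationary_distribution S K (distr \<Omega> S X)"
    and "stationary_distribution S K \<pi> \<Longrightarrow> \<pi> = distr \<Omega> S X"
proof -
  let ?\<pi> = "distr \<Omega> S X"
  interpret X: prob_space ?\<pi> by (rule \<Omega>.prob_space_distr[OF X])
  have limit: "(\<lambda>n. \<integral>y. f y \<partial>law n x) \<longlonglongrightarrow> (\<integral>y. f y \<partial>?\<pi>)"
    if x: "x \<in> space S" and f [measurable]: "f \<in> borel_measurable S"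
      and bounded: "\<And>y. \<bar>f y\<bar> \<le> 1" for f :: "_ \<Rightarrow> real" and x
  proof -
    have [measurable]: "path (- int n) 0 x \<in> \<Omega> \<rightarrow>\<^sub>M S" for n
      using x by (rule measurable_path) simp
    have "(\<lambda>n. \<integral>\<omega>. f (path (- int n) 0 x \<omega>) \<partial>\<Omega>) \<longlonglongrightarrow> (\<integral>\<omega>. f (X \<omega>) \<partial>\<Omega>)"
    proof (rule integral_dominated_convergence[where w = "\<lambda>_. 1"])
      show "AE \<omega> in \<Omega>. (\<lambda>n. f (path (- int n) 0 x \<omega>)) \<longlonglongrightarrow> f (X \<omega>)"
        using coupling[OF x]
      proof eventually_elim
        case (elim \<omega>)
        then have "\<forall>\<^sub>F n in sequentially. f (path (- int n) 0 x \<omega>) = f (X \<omega>)"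
          unfolding eventually_sequentially by metis
        then show ?case by (rule tendsto_eventually)
      qed
    qed (use bounded in auto)
    moreover have "(\<integral>\<omega>. f (path (- int n) 0 x \<omega>) \<partial>\<Omega>) = (\<integral>y. f y \<partial>law n x)" for n
      using distr_path[OF x, of "- int n" 0] integral_distr[of "path (- int n) 0 x" \<Omega> S f] by simp
    ultimately show ?thesis using integral_distr[OF X f] by (simp only:)
  qed
  have limit_measure: "(\<lambda>n. measure (law n x) A) \<longlonglongrightarrow> measure ?\<pi> A"
    if x: "x \<in> space S" and A: "A \<in> sets S" for x A
  proof -
    have "(\<integral>y. indicator A y \<partial>law n x) = measure (law n x) A" for n
      using sets.sets_into_space[of A "law n x"] sets_kernel[OF measurable_law x, of n] A
      by (simp add: Int_absorb2)
    moreover have "(\<integral>y. indicator A y \<partial>?\<pi>) = measure ?\<pi> A"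
      using sets.sets_into_space[OF A] by (simp add: Int_absorb2)
    moreover have "(\<lambda>n. \<integral>y. (indicator A y :: real) \<partial>law n x) \<longlonglongrightarrow> (\<integral>y. indicator A y \<partial>?\<pi>)"
      by (rule limit[OF x]) (use A in \<open>auto simp: indicator_def\<close>)
    ultimately show ?thesis by (simp only:)
  qed
  have subprob_law: "subprob_space (law n x)" if "x \<in> space S" for n x
    using that by (rule subprob_space_kernel[OF measurable_law])
  have law_meas: "K \<in> law n x \<rightarrow>\<^sub>M subprob_algebra S" if "x \<in> space S" for n x
    using measurable_kernel measurable_cong_sets[OF sets_kernel[OF measurable_law that] refl] by blast
  have "?\<pi> \<bind> K = ?\<pi>"
  proof (rule measure_eqI)
    have K: "K \<in> ?\<pi> \<rightarrow>\<^sub>M subprob_algebra S" by simp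
    show sets: "sets (?\<pi> \<bind> K) = sets ?\<pi>"
      using sets_bind[OF sets_kernel[OF K] X.not_empty] by simp
    interpret XK: prob_space "?\<pi> \<bind> K"
      using K by (intro X.prob_space_bind[where S = S]) (auto simp: prob_space_kernel)
    fix A assume "A \<in> sets (?\<pi> \<bind> K)"
    then have A: "A \<in> sets S" by (simp add: sets)
    \<comment> \<open>cut off outside the state space, where the kernel need not be a probability measure,
      so that the function is bounded everywhere\<close>
    let ?f = "\<lambda>y. if y \<in> space S then measure (K y) A else 0"
    have "(\<lambda>n. \<integral>y. ?f y \<partial>law n []) \<longlonglongrightarrow> (\<integral>y. ?f y \<partial>?\<pi>)"
    proof (rule limit[OF Nil_profiles])
      show "?f \<in> borel_measurable S"
        using measurable_compose[OF measurable_kernel measurable_measure_subprob_algebra[OF A]]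
        by (subst measurable_cong[where g = "\<lambda>y. measure (K y) A"]) auto
      show "\<bar>?f y\<bar> \<le> 1" for y
        using prob_space_kernel[of y] by (auto simp: prob_space.prob_le_1)
    qed
    moreover have "(\<integral>y. ?f y \<partial>law n []) = measure (law (Suc n) []) A" for n
    proof -
      interpret subprob_space "law n []" by (rule subprob_law[OF Nil_profiles])
      have "space (law n []) = space S"
        using sets_kernel[OF measurable_law Nil_profiles] by (rule sets_eq_imp_space_eq)
      then show ?thesis
        unfolding law.simps by (subst measure_bind[OF law_meas[OF Nil_profiles] A])
          (auto intro: Bochner_Integration.integral_cong)
    qed
    moreover have "(\<integral>y. ?f y \<partial>?\<pi>) = measure (?\<pi> \<bind> K) A"
      by (subst X.measure_bind[OF K A]) (auto intro: Bochner_Integration.integral_cong)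
    ultimately have "(\<lambda>n. measure (law (Suc n) []) A) \<longlonglongrightarrow> measure (?\<pi> \<bind> K) A" by simp
    moreover have "(\<lambda>n. measure (law (Suc n) []) A) \<longlonglongrightarrow> measure ?\<pi> A"
      by (rule LIMSEQ_Suc[OF limit_measure[OF Nil_profiles A]])
    ultimately have "measure (?\<pi> \<bind> K) A = measure ?\<pi> A" by (rule LIMSEQ_unique)
    then show "emeasure (?\<pi> \<bind> K) A = emeasure ?\<pi> A"
      by (simp add: X.emeasure_eq_measure XK.emeasure_eq_measure)
  qed
  then show "stationary_distribution S K ?\<pi>"
    by (simp add: stationary_iff_bind X.prob_space_axioms)

  assume stationary: "stationary_distribution S K \<pi>"
  then interpret \<pi>: prob_space \<pi> by (simp add: stationary_iff_bind)
  have sets: "sets \<pi> = sets S" using stationary by (simp add: stationary_iff_bind)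
  then have space: "space \<pi> = space S" by (rule sets_eq_imp_space_eq)
  have law: "law n \<in> \<pi> \<rightarrow>\<^sub>M subprob_algebra S" for n
    using measurable_law measurable_cong_sets[OF sets refl] by blast
  show "\<pi> = ?\<pi>"
  proof (rule measure_eqI)
    show "sets \<pi> = sets ?\<pi>" using sets by simp
    fix A assume "A \<in> sets \<pi>"
    then have A: "A \<in> sets S" by (simp add: sets)
    have "(\<lambda>n. \<integral>x. measure (law n x) A \<partial>\<pi>) \<longlonglongrightarrow> (\<integral>x. measure ?\<pi> A \<partial>\<pi>)"
    proof (rule integral_dominated_convergence[where w = "\<lambda>_. 1"])
      show "(\<lambda>x. measure (law n x) A) \<in> borel_measurable \<pi>" for n
        by (rule measurable_compose[OF law measurable_measure_subprob_algebra[OF A]])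
      show "AE x in \<pi>. (\<lambda>n. measure (law n x) A) \<longlonglongrightarrow> measure ?\<pi> A"
        by (rule AE_I2) (simp add: space limit_measure[OF _ A])
      show "AE x in \<pi>. norm (measure (law n x) A) \<le> 1" for n
        by (rule AE_I2) (auto simp: space intro!: subprob_space.subprob_measure_le_1 subprob_law)
    qed auto
    moreover have "(\<integral>x. measure (law n x) A \<partial>\<pi>) = measure \<pi> A" for n
      using \<pi>.measure_bind[OF law A, of n] stationary_bind_law[OF stationary, of n] by simp
    ultimately have "measure \<pi> A = measure ?\<pi> A"
      by (simp add: LIMSEQ_const_iff \<pi>.prob_space)
    then show "emeasure \<pi> A = emeasure ?\<pi> A"
      by (simp add: X.emeasure_eq_measure \<pi>.emeasure_eq_measure)
  qed
qed

end

section \<open>Stopping points of the sampler\<close>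

lemma finite_zero_times: "finite (zero_times p m T)"
  unfolding zero_times_def by (rule finite_subset[of _ "{T..0}"]) auto

text \<open>The stopping rule without \<open>LEAST\<close> and \<open>Min\<close>: the run started at \<open>-(2 ^ j)\<close> is the first one
  that reaches 0, and \<open>i\<close> is its first zero. In this form the rule is a countable combination of
  conditions on \<open>Y\<close>, which makes the output measurable.\<close>

definition stops :: "(int \<Rightarrow> real) \<Rightarrow> real \<Rightarrow> nat \<Rightarrow> int \<Rightarrow> bool" where
  "stops p m j i \<longleftrightarrow> i \<in> {- (2 ^ j)..0} \<and> dominating p m (- (2 ^ j)) i = 0 \<and>
     (\<forall>i'\<in>{- (2 ^ j)..<i}. dominating p m (- (2 ^ j)) i' \<noteq> 0) \<and>
     (\<forall>j'<j. \<forall>i'\<in>{- (2 ^ j')..0}. dominating p m (- (2 ^ j')) i' \<noteq> 0)"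

lemma sampler_eq_run_if_stops:
  assumes "stops p m j i"
  shows "sampler G \<Phi> m p v u = Some (run G \<Phi> (\<lambda>n. ((p n, v n), u n)) i 0 [])"
proof -
  have terminates: "zero_times p m (- (2 ^ j)) \<noteq> {}"
    using assms by (auto simp: stops_def zero_times_def)
  have "(LEAST j::nat. zero_times p m (- (2 ^ j)) \<noteq> {}) = j"
  proof (rule Least_equality)
    show "zero_times p m (- (2 ^ j)) \<noteq> {}" by (rule terminates)
    fix j' :: nat assume nonempty: "zero_times p m (- (2 ^ j')) \<noteq> {}"
    show "j \<le> j'"
    proof (rule ccontr)
      assume "\<not> j \<le> j'"
      then show False using assms nonempty by (auto simp: stops_def zero_times_def)
    qed
  qed
  moreover have "Min (zero_times p m (- (2 ^ j))) = i"
  proof (rule Min_eqI)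
    show "finite (zero_times p m (- (2 ^ j)))" by (rule finite_zero_times)
    show "i \<in> zero_times p m (- (2 ^ j))" using assms by (simp add: stops_def zero_times_def)
    fix i' assume "i' \<in> zero_times p m (- (2 ^ j))"
    then show "i \<le> i'" using assms by (force simp: stops_def zero_times_def)
  qed
  ultimately show ?thesis
    using terminates by (auto simp: sampler_def sampler_terminates_def run_def Let_def)
qed

lemma ex_stops_if_terminates:
  assumes "sampler_terminates p m"
  shows "\<exists>j i. stops p m j i"
proof -
  define j where "j = (LEAST j::nat. zero_times p m (- (2 ^ j)) \<noteq> {})"
  define i where "i = Min (zero_times p m (- (2 ^ j)))"
  have "zero_times p m (- (2 ^ j)) \<noteq> {}"
    unfolding j_def by (rule LeastI_ex) (use assms in \<open>simp add: sampler_terminates_def\<close>)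
  then have i: "i \<in> zero_times p m (- (2 ^ j))"
    unfolding i_def by (intro Min_in finite_zero_times)
  have earlier: "dominating p m (- (2 ^ j)) i' \<noteq> 0" if "i' \<in> {- (2 ^ j)..<i}" for i'
  proof
    assume "dominating p m (- (2 ^ j)) i' = 0"
    then have "i' \<in> zero_times p m (- (2 ^ j))" using that i by (simp add: zero_times_def)
    then have "i \<le> i'" unfolding i_def by (intro Min_le finite_zero_times)
    then show False using that by simp
  qed
  have "zero_times p m (- (2 ^ j')) = {}" if "j' < j" for j'
    using not_less_Least[of j' "\<lambda>j::nat. zero_times p m (- (2 ^ j)) \<noteq> {}"] that
    unfolding j_def by blast
  then have "stops p m j i" using i earlier by (auto simp: stops_def zero_times_def)
  then show ?thesis by blast
qed

section \<open>The stationary profile\<close>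

locale impatient_matching_chain = driven_matching_chain G D \<Phi> \<mu> \<Omega> W
  for G :: "'v pair_pre_digraph"
    and D :: "'u measure"
    and \<Phi> :: "(real \<times> 'v) list \<Rightarrow> 'v \<Rightarrow> 'u \<Rightarrow> nat"
    and \<mu> :: "(real \<times> 'v) measure"
    and \<Omega> :: "'w measure"
    and W :: "int \<Rightarrow> 'w \<Rightarrow> (real \<times> 'v) \<times> 'u" +
  assumes integrable_patience: "integrable \<mu> fst"
    and short_patience: "measure \<mu> {z \<in> space \<mu>. fst z \<le> 1} > 0"
begin

abbreviation patience :: "int \<Rightarrow> 'w \<Rightarrow> real" where
  "patience n \<omega> \<equiv> fst (fst (W n \<omega>))"

lemma measurable_fst_\<mu> [measurable]: "fst \<in> borel_measurable \<mu>"
  using measurable_fst_mark measurable_cong_sets[OF mark_law(2) refl] by blast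

lemma distr_mark: "distr \<Omega> \<mu> (\<lambda>\<omega>. fst (W n \<omega>)) = \<mu>"
proof -
  have "distr \<Omega> \<mu> (\<lambda>\<omega>. fst (W n \<omega>)) = distr (distr \<Omega> \<nu> (W n)) \<mu> fst"
    by (simp add: distr_distr comp_def)
  also have "\<dots> = \<mu>" by (simp add: distr_input draw.distr_pair_fst)
  finally show ?thesis .
qed

lemma measurable_patience [measurable]: "patience n \<in> borel_measurable \<Omega>"
  by (rule measurable_compose[OF measurable_compose[OF measurable_input measurable_fst] measurable_fst_\<mu>])

lemma distr_patience: "distr \<Omega> borel (patience n) = distr \<mu> borel fst"
proof -
  have "distr \<Omega> borel (patience n) = distr (distr \<Omega> \<mu> (\<lambda>\<omega>. fst (W n \<omega>))) borel fst"
    by (simp add: distr_distr comp_def)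
  then show ?thesis by (simp add: distr_mark)
qed

text \<open>Time is reversed and counted from \<open>-1\<close> to obtain a sequence indexed by the natural numbers; the
  singletons \<open>{-1 - j}\<close> serve as disjoint blocks of inputs.\<close>

lemma indep_patience: "\<Omega>.indep_vars (\<lambda>_. borel) (\<lambda>j. patience (- 1 - int j)) UNIV"
proof -
  let ?K = "\<lambda>j. {- 1 - int j}"
  have "\<Omega>.indep_vars (\<lambda>j. PiM (?K j) (\<lambda>_. \<nu>)) (\<lambda>j \<omega>. \<lambda>i\<in>?K j. W i \<omega>) UNIV"
    by (rule \<Omega>.indep_vars_restrict[OF indep_inputs]) (auto simp: disjoint_family_on_def)
  moreover have "(\<lambda>w. fst (fst (w (- 1 - int j)))) \<in> borel_measurable (PiM (?K j) (\<lambda>_. \<nu>))" for j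
  proof -
    have "(\<lambda>w. w (- 1 - int j)) \<in> PiM (?K j) (\<lambda>_. \<nu>) \<rightarrow>\<^sub>M \<nu>"
      by (intro measurable_component_singleton) simp
    then show ?thesis
      by (rule measurable_compose[OF measurable_compose[OF _ measurable_fst] measurable_fst_\<mu>])
  qed
  ultimately have "\<Omega>.indep_vars (\<lambda>_. borel)
      (\<lambda>j \<omega>. fst (fst ((\<lambda>i\<in>?K j. W i \<omega>) (- 1 - int j)))) UNIV"
    by (rule \<Omega>.indep_vars_compose2)
  then show ?thesis by simp
qed

text \<open>At time \<open>-N\<close> all earlier arrivals have expired; the arrival \<open>1 + j\<close> time units before it may have
  patience at most \<open>1 + j\<close>.\<close>

definition regenerates :: "nat \<Rightarrow> 'w \<Rightarrow> bool" where
  "regenerates N \<omega> \<longleftrightarrow> (\<forall>j::nat. patience (- int N - 1 - int j) \<omega> \<le> 1 + real j)"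

lemma measurable_regenerates [measurable]: "Measurable.pred \<Omega> (regenerates N)"
  unfolding regenerates_def by measurable

lemma AE_ex_regenerates: "AE \<omega> in \<Omega>. \<exists>N. regenerates N \<omega>"
proof -
  have "integrable \<Omega> (patience (- 1 - int 0))"
  proof -
    have "integrable (distr \<Omega> \<mu> (\<lambda>\<omega>. fst (W (- 1 - int 0) \<omega>))) fst"
      unfolding distr_mark by (rule integrable_patience)
    then show ?thesis by (subst (asm) integrable_distr_eq) simp_all
  qed
  moreover have "\<Omega>.prob {\<omega> \<in> space \<Omega>. patience (- 1 - int 0) \<omega> \<le> 1} > 0"
  proof -
    have "\<Omega>.prob {\<omega> \<in> space \<Omega>. patience n \<omega> \<le> 1} = measure (distr \<Omega> borel (patience n)) {..1}" for n
      by (subst measure_distr) (auto intro!: arg_cong[where f = \<Omega>.prob])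
    moreover have "measure (distr \<mu> borel fst) {..1} = measure \<mu> {z \<in> space \<mu>. fst z \<le> 1}"
      by (subst measure_distr) (auto intro!: arg_cong[where f = "measure \<mu>"])
    ultimately show ?thesis using short_patience by (simp only: distr_patience)
  qed
  ultimately have "AE \<omega> in \<Omega>. \<exists>n. \<forall>j\<ge>n. patience (- 1 - int j) \<omega> \<le> 1 + real j - real n"
    using indep_patience distr_patience by (intro \<Omega>.AE_ex_countdown) simp_all
  then show ?thesis
  proof eventually_elim
    case (elim \<omega>)
    then obtain n where n: "\<forall>j\<ge>n. patience (- 1 - int j) \<omega> \<le> 1 + real j - real n" ..
    have "patience (- int n - 1 - int j) \<omega> \<le> 1 + real j" for j
    proof -
      have eq: "- 1 - int (n + j) = - int n - 1 - int j" by simp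
      show ?thesis using n[rule_format, of "n + j", unfolded eq] by simp
    qed
    then show ?case by (auto simp: regenerates_def)
  qed
qed

lemma dominating_nonpos_if_regenerates:
  assumes "regenerates N \<omega>" "real N + m \<le> - real_of_int s" "0 \<le> m"
  shows "dominating (\<lambda>n. patience n \<omega>) m s (- int N) \<le> 0"
proof -
  have "patience k \<omega> \<le> real_of_int (- int N - k)" if "k < - int N" for k
  proof -
    have "- int N - 1 - int (nat (- int N - 1 - k)) = k" using that by simp
    then show ?thesis
      using assms(1)[unfolded regenerates_def, rule_format, of "nat (- int N - 1 - k)"] that by simp
  qed
  then have "dominating (\<lambda>n. patience n \<omega>) m s (- int N) \<le> real_of_int (- int N - (- int N))"
    using assms(2,3) by (intro dominating_le_countdown) auto
  then show ?thesis by simp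
qed

text \<open>Any measurable choice of a regeneration time would give the same profile at time 0; the latest one
  is chosen because \<open>LEAST\<close> preserves measurability.\<close>

definition last_regeneration :: "'w \<Rightarrow> nat" where
  "last_regeneration \<omega> = (LEAST N. regenerates N \<omega>)"

definition stationary_profile :: "'w \<Rightarrow> (real \<times> 'v) list" where
  "stationary_profile \<omega> = path (- int (last_regeneration \<omega>)) 0 [] \<omega>"

lemma measurable_stationary_profile [measurable]: "stationary_profile \<in> \<Omega> \<rightarrow>\<^sub>M S"
proof -
  have path: "path (- int N) 0 [] \<in> \<Omega> \<rightarrow>\<^sub>M S" for N
    by (rule measurable_path[OF Nil_profiles]) simp
  have "last_regeneration \<in> \<Omega> \<rightarrow>\<^sub>M count_space UNIV"
    unfolding last_regeneration_def[abs_def] by measurable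
  from measurable_compose_countable[where f = "\<lambda>N. path (- int N) 0 []", OF path this]
  show ?thesis unfolding stationary_profile_def[abs_def] .
qed

lemma profile_patience_bounded:
  assumes "x \<in> space S"
  obtains m where "0 \<le> m" "\<forall>a\<in>set x. 0 < fst a \<and> fst a \<le> m"
proof
  have "0 < fst a" if "a \<in> set x" for a
    using assms that by (fastforce simp: item_space_def space_pair_measure)
  moreover have "fst a \<le> sum_list (map (\<lambda>a. \<bar>fst a\<bar>) x)" if "a \<in> set x" for a
    using member_le_sum_list[of "\<bar>fst a\<bar>" "map (\<lambda>a. \<bar>fst a\<bar>) x"] that by fastforce
  ultimately show "\<forall>a\<in>set x. 0 < fst a \<and> fst a \<le> sum_list (map (\<lambda>a. \<bar>fst a\<bar>) x)" by blast
  show "0 \<le> sum_list (map (\<lambda>a. \<bar>fst a\<bar>) x)" by (intro sum_list_nonneg) auto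
qed

text \<open>The coupling: at the last regeneration time every run that started early enough for its initial
  items to have expired is empty, and from then on all these runs coincide.\<close>

lemma path_eventually_stationary_profile:
  assumes "x \<in> space S" "\<exists>N. regenerates N \<omega>"
  shows "\<exists>N. \<forall>n\<ge>N. path (- int n) 0 x \<omega> = stationary_profile \<omega>"
proof -
  define L where "L = last_regeneration \<omega>"
  have L: "regenerates L \<omega>"
    unfolding L_def last_regeneration_def using assms(2) by (rule LeastI_ex)
  obtain m where m: "0 \<le> m" "\<forall>a\<in>set x. 0 < fst a \<and> fst a \<le> m"
    using profile_patience_bounded[OF assms(1)] .
  have "path (- int n) 0 x \<omega> = stationary_profile \<omega>" if n: "n \<ge> L + nat \<lceil>m\<rceil>" for n
  proof -
    have le: "- int n \<le> - int L" "- int L \<le> 0" using n by simp_all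
    have "real L + m \<le> - real_of_int (- int n)" using n m(1) by linarith
    from dominating_nonpos_if_regenerates[OF L this m(1)]
    have "path (- int n) (- int L) x \<omega> = []"
      by (rule run_empty_if_dominating_nonpos[OF le(1) m(2)])
    then show ?thesis
      unfolding stationary_profile_def L_def[symmetric] using run_split[OF le] by metis
  qed
  then show ?thesis by blast
qed

lemma stationary_profile_law:
  "stationary_distribution S K (distr \<Omega> S stationary_profile)"
  "stationary_distribution S K \<pi> \<Longrightarrow> \<pi> = distr \<Omega> S stationary_profile"
proof -
  have coupling: "AE \<omega> in \<Omega>. \<exists>N. \<forall>n\<ge>N. path (- int n) 0 x \<omega> = stationary_profile \<omega>"
    if "x \<in> space S" for x
    using AE_ex_regenerates by eventually_elim (rule path_eventually_stationary_profile[OF that])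
  show "stationary_distribution S K (distr \<Omega> S stationary_profile)"
    by (rule coupling_from_the_past(1)[OF measurable_stationary_profile coupling])
  show "stationary_distribution S K \<pi> \<Longrightarrow> \<pi> = distr \<Omega> S stationary_profile"
    by (rule coupling_from_the_past(2)[OF measurable_stationary_profile coupling])
qed

section \<open>The sampling algorithm\<close>

text \<open>Starting \<open>m\<close> time units or more before the regeneration time, \<open>Y\<close> has counted down to 0 there,
  and the starting times \<open>-(2 ^ j)\<close> are eventually that early.\<close>

lemma terminates_if_regenerates:
  assumes "regenerates N \<omega>" "0 < m"
  shows "sampler_terminates (\<lambda>n. patience n \<omega>) m"
proof -
  obtain j :: nat where j: "real N + m < 2 ^ j"
    using real_arch_pow[of 2 "real N + m"] by auto
  have "real N < 2 ^ j" using j assms(2) by linarith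
  then have "real_of_int (int N) < real_of_int (2 ^ j)"
    by (simp only: of_int_of_nat_eq of_int_power of_int_numeral)
  then have "int N < 2 ^ j" by (simp only: of_int_less_iff)
  then have N: "- (2 ^ j) \<le> - int N" by simp
  have "dominating (\<lambda>n. patience n \<omega>) m (- (2 ^ j)) (- int N) \<le> 0"
    using j assms by (intro dominating_nonpos_if_regenerates) auto
  moreover have "0 \<le> dominating (\<lambda>n. patience n \<omega>) m (- (2 ^ j)) (- int N)"
    using N assms(2) by (intro dominating_nonneg) auto
  ultimately have "- int N \<in> zero_times (\<lambda>n. patience n \<omega>) m (- (2 ^ j))"
    using N by (simp add: zero_times_def)
  then show ?thesis unfolding sampler_terminates_def by blast
qed

text \<open>A run from the empty profile that started earlier holds only items of patience at most \<open>m\<close> when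
  the sampler starts \<open>Y\<close> from \<open>m\<close>, so \<open>Y\<close> dominates it, and the zero of \<open>Y\<close> at
  \<open>i\<close> means that it is empty at \<open>i\<close>.\<close>

lemma stationary_profile_eq_path_if_stops:
  assumes "stops (\<lambda>n. patience n \<omega>) m j i" "\<exists>N. regenerates N \<omega>"
    and "0 < m" "\<And>n. patience n \<omega> \<le> m"
  shows "stationary_profile \<omega> = path i 0 [] \<omega>"
proof -
  obtain N where N: "\<forall>n\<ge>N. path (- int n) 0 [] \<omega> = stationary_profile \<omega>"
    using path_eventually_stationary_profile[OF Nil_profiles assms(2)] ..
  \<comment> \<open>early enough for the coupling, and no later than the start of the sampler\<close>
  define n where "n = max N (2 ^ j)"
  have i: "- (2 ^ j) \<le> i" "i \<le> 0" and zero: "dominating (\<lambda>n. patience n \<omega>) m (- (2 ^ j)) i = 0"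
    using assms(1) by (auto simp: stops_def)
  have "int (2 ^ j) \<le> int n" unfolding n_def by (intro zle_int[THEN iffD2]) simp
  then have n: "- int n \<le> - (2 ^ j)" by simp
  let ?y = "path (- int n) (- (2 ^ j)) [] \<omega>"
  have "\<forall>a\<in>set ?y. fst a \<le> dominating (\<lambda>n. patience n \<omega>) m (- int n) (- (2 ^ j))"
    by (rule run_patience_le_dominating[OF n]) simp
  moreover have "dominating (\<lambda>n. patience n \<omega>) m (- int n) (- (2 ^ j)) \<le> m"
    using assms(3,4) by (intro dominating_le_bound[OF n]) auto
  moreover have "\<forall>a\<in>set ?y. 0 < fst a" by (rule run_patience_pos[OF n]) simp
  ultimately have y: "\<forall>a\<in>set ?y. 0 < fst a \<and> fst a \<le> m" by (meson order_trans)
  have "path (- int n) i [] \<omega> = path (- (2 ^ j)) i ?y \<omega>"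
    by (rule run_split[OF n i(1)])
  also have "\<dots> = []"
    by (rule run_empty_if_dominating_nonpos[OF i(1) y]) (simp only: zero order_refl)
  finally have empty: "path (- int n) i [] \<omega> = []" .
  have "stationary_profile \<omega> = path (- int n) 0 [] \<omega>" using N by (simp add: n_def)
  also have "\<dots> = path i 0 (path (- int n) i [] \<omega>) \<omega>"
    by (rule run_split[OF order_trans[OF n i(1)] i(2)])
  finally show ?thesis unfolding empty .
qed

abbreviation sample :: "real \<Rightarrow> 'w \<Rightarrow> (real \<times> 'v) list option" where
  "sample m \<omega> \<equiv>
    sampler G \<Phi> m (\<lambda>n. patience n \<omega>) (\<lambda>n. snd (fst (W n \<omega>))) (\<lambda>n. snd (W n \<omega>))"

lemma sample_eq_path_if_stops:
  assumes "stops (\<lambda>n. patience n \<omega>) m j i"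
  shows "sample m \<omega> = Some (path i 0 [] \<omega>)"
  using sampler_eq_run_if_stops[OF assms, of G \<Phi> "\<lambda>n. snd (fst (W n \<omega>))" "\<lambda>n. snd (W n \<omega>)"]
  by simp

lemma measurable_dominating:
  assumes "s \<le> t"
  shows "(\<lambda>\<omega>. dominating (\<lambda>n. patience n \<omega>) m s t) \<in> borel_measurable \<Omega>"
  using assms
proof (induction t rule: int_ge_induct)
  case base
  then show ?case by (simp add: dominating_refl)
next
  case (step t)
  note [measurable] = step.IH
  show ?case unfolding dominating_step[OF step.hyps] patience_step_def by measurable
qed

lemma measurable_no_zero:
  assumes "I \<subseteq> {s..}"
  shows "Measurable.pred \<Omega> (\<lambda>\<omega>. \<forall>i\<in>I. dominating (\<lambda>n. patience n \<omega>) m s i \<noteq> 0)"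
proof -
  have "Measurable.pred \<Omega> (\<lambda>\<omega>. \<forall>i. i \<in> I \<longrightarrow> dominating (\<lambda>n. patience n \<omega>) m s i \<noteq> 0)"
  proof (rule pred_intros_countable)
    fix i
    show "Measurable.pred \<Omega> (\<lambda>\<omega>. i \<in> I \<longrightarrow> dominating (\<lambda>n. patience n \<omega>) m s i \<noteq> 0)"
    proof (cases "i \<in> I")
      case True
      then have [measurable]: "(\<lambda>\<omega>. dominating (\<lambda>n. patience n \<omega>) m s i) \<in> borel_measurable \<Omega>"
        using assms by (intro measurable_dominating) auto
      show ?thesis using True by simp
    qed simp
  qed
  then show ?thesis unfolding Ball_def .
qed

lemma measurable_stops: "Measurable.pred \<Omega> (\<lambda>\<omega>. stops (\<lambda>n. patience n \<omega>) m j i)"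
proof (cases "i \<in> {- (2 ^ j)..0}")
  case True
  then have [measurable]:
    "(\<lambda>\<omega>. dominating (\<lambda>n. patience n \<omega>) m (- (2 ^ j)) i) \<in> borel_measurable \<Omega>"
    by (intro measurable_dominating) simp
  have [measurable]: "Measurable.pred \<Omega>
      (\<lambda>\<omega>. \<forall>i'\<in>{- (2 ^ j)..<i}. dominating (\<lambda>n. patience n \<omega>) m (- (2 ^ j)) i' \<noteq> 0)"
    by (rule measurable_no_zero) auto
  have [measurable]: "Measurable.pred \<Omega>
      (\<lambda>\<omega>. \<forall>i'\<in>{- (2 ^ j')..0}. dominating (\<lambda>n. patience n \<omega>) m (- (2 ^ j')) i' \<noteq> 0)" for j'
    by (rule measurable_no_zero) auto
  show ?thesis unfolding stops_def by measurable
qed (simp add: stops_def)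

text \<open>Splitting by the stopping point \<open>(j, i)\<close> turns the output into countably many runs with
  deterministic starting time.\<close>

lemma sample_event_sets:
  assumes "A \<in> sets S"
  shows "{\<omega> \<in> space \<Omega>. sample m \<omega> \<in> Some ` A} \<in> sets \<Omega>"
proof -
  have "{\<omega> \<in> space \<Omega>. sample m \<omega> \<in> Some ` A} =
    (\<Union>j. \<Union>i\<in>{..0}. {\<omega> \<in> space \<Omega>. stops (\<lambda>n. patience n \<omega>) m j i} \<inter> (path i 0 [] -` A \<inter> space \<Omega>))"
    (is "?L = ?R")
  proof (intro equalityI subsetI)
    fix \<omega> assume \<omega>: "\<omega> \<in> ?L"
    then have "sampler_terminates (\<lambda>n. patience n \<omega>) m"
      by (auto simp: sampler_def split: if_splits)
    then obtain j i where stops: "stops (\<lambda>n. patience n \<omega>) m j i"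
      using ex_stops_if_terminates by blast
    then have "i \<le> 0" by (simp add: stops_def)
    moreover have "path i 0 [] \<omega> \<in> A" using \<omega> sample_eq_path_if_stops[OF stops] by auto
    ultimately show "\<omega> \<in> ?R" using stops \<omega> by blast
  next
    fix \<omega> assume "\<omega> \<in> ?R"
    then obtain j i where "stops (\<lambda>n. patience n \<omega>) m j i" "path i 0 [] \<omega> \<in> A" "\<omega> \<in> space \<Omega>"
      by blast
    then show "\<omega> \<in> ?L" using sample_eq_path_if_stops by auto
  qed
  also have "\<dots> \<in> sets \<Omega>"
  proof -
    have stops: "{\<omega> \<in> space \<Omega>. stops (\<lambda>n. patience n \<omega>) m j i} \<in> sets \<Omega>" for j i
      using measurable_stops by (simp only: pred_def)
    have path: "path i 0 [] -` A \<inter> space \<Omega> \<in> sets \<Omega>" if "i \<in> {..0}" for i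
      using that by (intro measurable_sets[OF measurable_path assms] Nil_profiles) simp
    have "{\<omega> \<in> space \<Omega>. stops (\<lambda>n. patience n \<omega>) m j i} \<inter>
        (path i 0 [] -` A \<inter> space \<Omega>) \<in> sets \<Omega>" if "i \<in> {..0}" for i j
      by (rule sets.Int[OF stops path[OF that]])
    then show ?thesis by (intro sets.countable_UN'') simp_all
  qed
  finally show ?thesis .
qed

lemma AE_patience_le:
  assumes "measure \<mu> {z \<in> space \<mu>. fst z \<le> m} = 1"
  shows "AE \<omega> in \<Omega>. \<forall>n. patience n \<omega> \<le> m"
proof -
  have "AE \<omega> in \<Omega>. patience n \<omega> \<le> m" for n
  proof -
    from mark.AE_prob_1[OF assms] have "AE z in \<mu>. fst z \<le> m" by eventually_elim simp
    then have "AE z in distr \<Omega> \<mu> (\<lambda>\<omega>. fst (W n \<omega>)). fst z \<le> m" by (simp only: distr_mark)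
    then show ?thesis by (rule AE_distrD[rotated]) measurable
  qed
  then show ?thesis by (simp add: AE_all_countable)
qed

lemma AE_sampler_terminates:
  assumes "0 < m"
  shows "AE \<omega> in \<Omega>. sampler_terminates (\<lambda>n. patience n \<omega>) m"
  using AE_ex_regenerates by eventually_elim (use terminates_if_regenerates assms in blast)

lemma AE_sample_eq_stationary_profile:
  assumes "0 < m" "measure \<mu> {z \<in> space \<mu>. fst z \<le> m} = 1"
  shows "AE \<omega> in \<Omega>. sample m \<omega> = Some (stationary_profile \<omega>)"
  using AE_ex_regenerates AE_patience_le[OF assms(2)] AE_sampler_terminates[OF assms(1)]
proof eventually_elim
  case (elim \<omega>)
  obtain j i where stops: "stops (\<lambda>n. patience n \<omega>) m j i"
    using ex_stops_if_terminates[OF elim(3)] by blast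
  have "patience n \<omega> \<le> m" for n using elim(2) ..
  then show ?case
    using stationary_profile_eq_path_if_stops[OF stops elim(1) assms(1)]
      sample_eq_path_if_stops[OF stops] by simp
qed

lemma sample_law:
  assumes "0 < m" "measure \<mu> {z \<in> space \<mu>. fst z \<le> m} = 1"
    and "stationary_distribution S K \<pi>" "A \<in> sets S"
  shows "measure \<Omega> {\<omega> \<in> space \<Omega>. sample m \<omega> \<in> Some ` A} = measure \<pi> A"
proof -
  have "measure \<Omega> {\<omega> \<in> space \<Omega>. sample m \<omega> \<in> Some ` A} = measure \<Omega> (stationary_profile -` A \<inter> space \<Omega>)"
  proof (rule measure_eq_AE)
    show "AE \<omega> in \<Omega>. \<omega> \<in> {\<omega> \<in> space \<Omega>. sample m \<omega> \<in> Some ` A} \<longleftrightarrow>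
        \<omega> \<in> stationary_profile -` A \<inter> space \<Omega>"
      using AE_sample_eq_stationary_profile[OF assms(1,2)] by eventually_elim auto
    show "{\<omega> \<in> space \<Omega>. sample m \<omega> \<in> Some ` A} \<in> sets \<Omega>"
      using assms(4) by (rule sample_event_sets)
    show "stationary_profile -` A \<inter> space \<Omega> \<in> sets \<Omega>"
      using measurable_stationary_profile assms(4) by (rule measurable_sets)
  qed
  also have "\<dots> = measure (distr \<Omega> S stationary_profile) A"
    by (rule measure_distr[OF measurable_stationary_profile assms(4), symmetric])
  finally show ?thesis unfolding stationary_profile_law(2)[OF assms(3), symmetric] .
qed

end

theorem theorem2:
  fixes G :: "'v pair_pre_digraph"
    and D :: "'u measure"
    and \<Phi> :: "(real \<times> 'v) list \<Rightarrow> 'v \<Rightarrow> 'u \<Rightarrow> nat"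
    and \<mu> :: "(real \<times> 'v) measure"
    and \<Omega> :: "'w measure"
    and P :: "int \<Rightarrow> 'w \<Rightarrow> real"
    and V :: "int \<Rightarrow> 'w \<Rightarrow> 'v"
    and U :: "int \<Rightarrow> 'w \<Rightarrow> 'u"
  assumes graph: "pair_graph G" "Digraph_Component.connected (with_proj G)"
    and draw_law: "prob_space D"
    and policy: "admissible G D \<Phi>"
    and mark_law: "prob_space \<mu>" "sets \<mu> = sets (mark_space G)"
    and prob_space: "prob_space \<Omega>"
    and independent: "prob_space.indep_vars \<Omega> (\<lambda>_. \<mu> \<Otimes>\<^sub>M D)
           (\<lambda>n \<omega>. ((P n \<omega>, V n \<omega>), U n \<omega>)) UNIV"
    and identically_distributed:
      "\<And>n. distr \<Omega> (\<mu> \<Otimes>\<^sub>M D) (\<lambda>\<omega>. ((P n \<omega>, V n \<omega>), U n \<omega>)) = \<mu> \<Otimes>\<^sub>M D"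
    and integrable_patience: "integrable \<mu> fst"
    and short_patience: "measure \<mu> {z \<in> space \<mu>. fst z \<le> 1} > 0"
  shows "(\<exists>!\<pi>. stationary_distribution (profile_space G) (profile_kernel G \<Phi> \<mu> D) \<pi>) \<and>
    (\<forall>m > 0. measure \<mu> {z \<in> space \<mu>. fst z \<le> m} = 1 \<longrightarrow>
       (AE \<omega> in \<Omega>. sampler_terminates (\<lambda>n. P n \<omega>) m) \<and>
       (\<forall>\<pi>. stationary_distribution (profile_space G) (profile_kernel G \<Phi> \<mu> D) \<pi> \<longrightarrow>
          (\<forall>A \<in> sets (profile_space G).
             measure \<Omega> {\<omega> \<in> space \<Omega>.
               sampler G \<Phi> m (\<lambda>n. P n \<omega>) (\<lambda>n. V n \<omega>) (\<lambda>n. U n \<omega>) \<in> Some ` A} = measure \<pi> A)))"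
proof -
  have "countable (pverts G)"
  proof -
    interpret pair_graph G by (rule graph(1))
    show ?thesis by (rule countable_finite[OF pair_finite_verts])
  qed
  then have chain: "matching_chain G D \<Phi> \<mu>"
    using draw_law policy mark_law by (rule matching_chain.intro)
  interpret impatient_matching_chain G D \<Phi> \<mu> \<Omega> "\<lambda>n \<omega>. ((P n \<omega>, V n \<omega>), U n \<omega>)"
    by (intro impatient_matching_chain.intro impatient_matching_chain_axioms.intro
        driven_matching_chain.intro driven_matching_chain_axioms.intro chain prob_space
        independent identically_distributed integrable_patience short_patience)
  have "\<exists>!\<pi>. stationary_distribution S K \<pi>"
    using stationary_profile_law by blast
  moreover have "AE \<omega> in \<Omega>. sampler_terminates (\<lambda>n. P n \<omega>) m" if "0 < m" for m
    using AE_sampler_terminates[OF that] by simp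
  moreover have "measure \<Omega> {\<omega> \<in> space \<Omega>.
      sampler G \<Phi> m (\<lambda>n. P n \<omega>) (\<lambda>n. V n \<omega>) (\<lambda>n. U n \<omega>) \<in> Some ` A} = measure \<pi> A"
    if "0 < m" "measure \<mu> {z \<in> space \<mu>. fst z \<le> m} = 1"
      "stationary_distribution S K \<pi>" "A \<in> sets S" for m \<pi> A
    using sample_law[OF that] by simp
  ultimately show ?thesis by blast
qed

end
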